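(* Let $q\in\mathcal{P}[0,1]$ and let $\{\lambda(t)\}_{t\in(0,1)}$, $\lambda(t)=\lambda(t,q)$, be the complete spectral data of the problems $(E_{t,q})$, $0<t<1$. Then the potential $q$ is uniquely determined by, and can be reconstructed from, $\{\lambda(t)\}_{t\in(0,1)}$, and $$q(x)=-\frac12\cdot\frac{\lambda''(x)}{\lambda(x)}+\frac34\left(\frac{\lambda'(x)}{\lambda(x)}\right)^2+\frac14\lambda(x)^2\quad\text{on }(0,1)$$ (equality of $L^1$ functions, i.e. almost everywhere).
   Context: For $t\in(0,1)$ and $q\in L^1([0,1],\mathbb{R})$, $(E_{t,q})$ is the problem $-y''+qy=\lambda\delta(x-t)y$ on $[0,1]$, $y(0)=y(1)=0$, with $\delta(x-t)$ the Dirac delta at $t$. For $\lambda\in\mathbb{C}$, a solution is a function $y:[0,1]\to\mathbb{C}$, absolutely continuous on $[0,1]$, with $y'$ absolutely continuous on $(0,t)$ and on $(t,1)$, such that $y'(t^\pm)$ exist, $-y''+qy=0$ a.e. off $t$, $y'(t^-)-y'(t^+)=\lambda y(t)$ and $y(0)=y(1)=0$; $\lambda$ is an eigenvalue if there is a solution not identically zero. $\mathcal{P}[0,1]$ is the set of all $q\in L^1([0,1],\mathbb{R})$ such that for every $t\in(0,1)$ the equation $-y''+qy=0$ has only the zero solution with $y(0)=y(1)=0$ on $[0,1]$, only the zero solution with $y(0)=y(t)=0$ on $[0,t]$, and only the zero solution with $y(t)=y(1)=0$ on $[t,1]$. For $q\in\mathcal{P}[0,1]$ and $t\in(0,1)$,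 $(E_{t,q})$ has a unique eigenvalue, denoted $\lambda(t,q)$ (it is real and non-zero); $\{\lambda(t,q)\}_{t\in(0,1)}$ is called the set of complete spectral data. *)

theory Defs
  imports "HOL-Analysis.Analysis"
begin

text \<open>
  Absolute continuity of a function on an interval \<open>S\<close>, which need not be closed.  Note that
  \<open>absolutely_continuous\<close> in the library is a relation between measures.
\<close>

definition abs_cont_on :: "real set \<Rightarrow> (real \<Rightarrow> 'a::real_normed_vector) \<Rightarrow> bool" where
  "abs_cont_on S f \<longleftrightarrow>
    (\<forall>\<epsilon>>0. \<exists>\<delta>>0. \<forall>(n::nat) a b.
      (\<forall>i<n. a i \<le> b i \<and> {a i..b i} \<subseteq> S) \<longrightarrow>
      disjoint_family_on (\<lambda>i. {a i<..<b i}) {..<n} \<longrightarrow>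
      (\<Sum>i<n. b i - a i) < \<delta> \<longrightarrow>
      (\<Sum>i<n. norm (f (b i) - f (a i))) < \<epsilon>)"

text \<open>
  The equation \<open>-y'' + q y = 0\<close> almost everywhere on \<open>S\<close>, where \<open>dy\<close> plays the role of \<open>y'\<close>.
\<close>

definition equation_ae :: "(real \<Rightarrow> real) \<Rightarrow> real set \<Rightarrow> (real \<Rightarrow> complex) \<Rightarrow> (real \<Rightarrow> complex) \<Rightarrow> bool" where
  "equation_ae q S y dy \<longleftrightarrow>
    (AE x\<in>S in lebesgue. \<exists>d. (dy has_vector_derivative d) (at x) \<and>
       - d + complex_of_real (q x) * y x = 0)"

text \<open>
  Functions on an interval are total functions of which only the values on that interval matter.
  At the end points of \<open>[a,b]\<close> the derivative \<open>y'\<close> is one-sided.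
\<close>

definition is_solution_on :: "(real \<Rightarrow> real) \<Rightarrow> real \<Rightarrow> real \<Rightarrow> (real \<Rightarrow> complex) \<Rightarrow> bool" where
  "is_solution_on q a b y \<longleftrightarrow>
    abs_cont_on {a..b} y \<and>
    (\<exists>dy. (\<forall>x\<in>{a..b}. (y has_vector_derivative dy x) (at x within {a..b})) \<and>
          abs_cont_on {a..b} dy \<and>
          equation_ae q {a..b} y dy)"

definition only_zero_dirichlet_solution :: "(real \<Rightarrow> real) \<Rightarrow> real \<Rightarrow> real \<Rightarrow> bool" where
  "only_zero_dirichlet_solution q a b \<longleftrightarrow>
    (\<forall>y. is_solution_on q a b y \<and> y a = 0 \<and> y b = 0 \<longrightarrow> (\<forall>x\<in>{a..b}. y x = 0))"

text \<open>
  The class \<open>\<P>[0,1]\<close>.  Its elements are functions rather than classes of functions modulo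
  equality almost everywhere.
\<close>

definition potentials :: "(real \<Rightarrow> real) set" where
  "potentials = {q. q absolutely_integrable_on {0..1} \<and>
    (\<forall>t\<in>{0<..<1}. only_zero_dirichlet_solution q 0 1 \<and>
                   only_zero_dirichlet_solution q 0 t \<and>
                   only_zero_dirichlet_solution q t 1)}"

text \<open>
  Solutions of \<open>(E\<^sub>t\<^sub>,\<^sub>q)\<close> for the parameter \<open>\<mu>\<close>; \<open>dl\<close> and \<open>dr\<close> are \<open>y'(t\<^sup>-)\<close> and \<open>y'(t\<^sup>+)\<close>.
\<close>

definition is_delta_solution ::
    "(real \<Rightarrow> real) \<Rightarrow> real \<Rightarrow> complex \<Rightarrow> (real \<Rightarrow> complex) \<Rightarrow> bool" where
  "is_delta_solution q t \<mu> y \<longleftrightarrow>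
    abs_cont_on {0..1} y \<and>
    (\<exists>dy dl dr.
      (\<forall>x\<in>{0<..<t} \<union> {t<..<1}. (y has_vector_derivative dy x) (at x)) \<and>
      abs_cont_on {0<..<t} dy \<and>
      abs_cont_on {t<..<1} dy \<and>
      equation_ae q ({0..1} - {t}) y dy \<and>
      (dy \<longlongrightarrow> dl) (at_left t) \<and>
      (dy \<longlongrightarrow> dr) (at_right t) \<and>
      dl - dr = \<mu> * y t) \<and>
    y 0 = 0 \<and> y 1 = 0"

definition is_eigenvalue :: "(real \<Rightarrow> real) \<Rightarrow> real \<Rightarrow> complex \<Rightarrow> bool" where
  "is_eigenvalue q t \<mu> \<longleftrightarrow> (\<exists>y. is_delta_solution q t \<mu> y \<and> (\<exists>x\<in>{0..1}. y x \<noteq> 0))"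

text \<open>
  \<open>\<lambda>(t,q)\<close>: the unique eigenvalue among all complex numbers, as the real number that it is.
\<close>

definition spectral_datum :: "(real \<Rightarrow> real) \<Rightarrow> real \<Rightarrow> real" where
  "spectral_datum q t = (THE r. {\<mu>. is_eigenvalue q t \<mu>} = {complex_of_real r})"

text \<open>
  The right-hand side of the reconstruction formula.  For \<open>x \<in> (0,1)\<close> it depends only on the
  values of \<open>\<Lambda>\<close> on \<open>(0,1)\<close>.
\<close>

definition reconstruct :: "(real \<Rightarrow> real) \<Rightarrow> real \<Rightarrow> real" where
  "reconstruct \<Lambda> x =
    - (1/2) * (deriv (deriv \<Lambda>) x / \<Lambda> x) + 3/4 * (deriv \<Lambda> x / \<Lambda> x)^2 + 1/4 * (\<Lambda> x)^2"

end

theory Submission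
  imports Defs
begin

text \<open>
  Let \<open>\<phi>\<close> and \<open>\<psi>\<close> be real solutions of \<open>-y'' + q y = 0\<close> with \<open>\<phi> 0 = 0\<close> and \<open>\<psi> 1 = 0\<close>, scaled so that
  their Wronskian \<open>\<phi>' \<psi> - \<phi> \<psi>'\<close>, which is constant, is \<open>1\<close>.  Such a pair exists, and neither function
  vanishes in \<open>(0,1)\<close>, because the three Dirichlet problems in the definition of the class
  of potentials have only the zero solution (\<open>dirichlet_pair_exists\<close>).

  A solution of the problem with the Dirac delta at \<open>t\<close> is a multiple of \<open>\<phi>\<close> on \<open>[0,t]\<close> and a multiple
  of \<open>\<psi>\<close> on \<open>[t,1]\<close>.  Its one-sided logarithmic derivatives at \<open>t\<close> are therefore \<open>\<phi>'/\<phi>\<close> and \<open>\<psi>'/\<psi>\<close>, and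
  the jump condition says that the eigenvalue is their difference:
  \<open>\<lambda>(t) = \<phi>'(t)/\<phi>(t) - \<psi>'(t)/\<psi>(t) = 1/(\<phi>(t) \<psi>(t))\<close>.  The eigenfunction is the Green function
  \<open>\<phi>(min x t) \<psi>(max x t)\<close>.

  So \<open>g = 1/\<lambda>\<close> is the product of two solutions.  It satisfies \<open>g'' = 2 q g + 2 \<phi>' \<psi>'\<close> almost
  everywhere, and the Wronskian gives \<open>g'\<^sup>2 = 1 + 4 g \<phi>' \<psi>'\<close>.  Eliminating \<open>\<phi>' \<psi>'\<close> yields
  \<open>4 q g\<^sup>2 = 2 g g'' - g'\<^sup>2 + 1\<close>, which is the reconstruction formula written in terms of \<open>\<lambda> = 1/g\<close>.
  The formula uses only \<open>\<lambda>\<close> on \<open>(0,1)\<close>, so it also shows that \<open>\<lambda>\<close> determines \<open>q\<close>.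

  Since \<open>q\<close> is merely integrable, two facts of real analysis carry the argument.  An absolutely
  continuous function with zero derivative almost everywhere is constant
  (\<open>abs_cont_on_const_endpoints\<close>); this makes Wronskians constant, also for the weakly
  differentiable solutions that the definition of an eigenvalue admits.  An indefinite integral is
  absolutely continuous and differentiable almost everywhere
  (\<open>abs_cont_on_indefinite_integral\<close>, \<open>indefinite_integral_derivative_ae\<close>); this turns the
  solution of an integral equation, found by the contraction principle, into a solution of the
  differential equation (\<open>initial_value_problem\<close>).
\<close>

section \<open>Absolutely continuous functions\<close>

lemma abs_cont_on_subset:
  assumes "abs_cont_on S f" "T \<subseteq> S"
  shows "abs_cont_on T f"
  using assms unfolding abs_cont_on_def by (meson order_trans)

text \<open>
  Sums, products and Lipschitz images of absolutely continuous functions all come from this one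
  estimate: the increments of \<open>h\<close> are bounded by those of \<open>f\<close> and \<open>g\<close>.  Taking \<open>g = f\<close> gives the
  versions with a single function.
\<close>

lemma abs_cont_on_dominated:
  fixes f :: "real \<Rightarrow> 'a::real_normed_vector" and g :: "real \<Rightarrow> 'b::real_normed_vector"
    and h :: "real \<Rightarrow> 'c::real_normed_vector"
  assumes f: "abs_cont_on S f" and g: "abs_cont_on S g"
    and h: "\<And>x y. x \<in> S \<Longrightarrow> y \<in> S \<Longrightarrow> norm (h y - h x) \<le> M * (norm (f y - f x) + norm (g y - g x))"
  shows "abs_cont_on S h"
  unfolding abs_cont_on_def
proof (intro allI impI)
  fix \<epsilon> :: real assume "\<epsilon> > 0"
  define K where "K = max M 1"
  have K: "K \<ge> 1" "M \<le> K" by (auto simp: K_def)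
  define e where "e = \<epsilon> / (2 * K)"
  have e: "e > 0" using \<open>\<epsilon> > 0\<close> K by (simp add: e_def)
  obtain d1 where d1: "d1 > 0" and D1: "\<And>(n::nat) a b. (\<forall>i<n. a i \<le> b i \<and> {a i..b i} \<subseteq> S) \<Longrightarrow>
      disjoint_family_on (\<lambda>i. {a i<..<b i}) {..<n} \<Longrightarrow> (\<Sum>i<n. b i - a i) < d1 \<Longrightarrow>
      (\<Sum>i<n. norm (f (b i) - f (a i))) < e"
    using f e unfolding abs_cont_on_def by meson
  obtain d2 where d2: "d2 > 0" and D2: "\<And>(n::nat) a b. (\<forall>i<n. a i \<le> b i \<and> {a i..b i} \<subseteq> S) \<Longrightarrow>
      disjoint_family_on (\<lambda>i. {a i<..<b i}) {..<n} \<Longrightarrow> (\<Sum>i<n. b i - a i) < d2 \<Longrightarrow>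
      (\<Sum>i<n. norm (g (b i) - g (a i))) < e"
    using g e unfolding abs_cont_on_def by meson
  show "\<exists>\<delta>>0. \<forall>(n::nat) a b. (\<forall>i<n. a i \<le> b i \<and> {a i..b i} \<subseteq> S) \<longrightarrow>
      disjoint_family_on (\<lambda>i. {a i<..<b i}) {..<n} \<longrightarrow> (\<Sum>i<n. b i - a i) < \<delta> \<longrightarrow>
      (\<Sum>i<n. norm (h (b i) - h (a i))) < \<epsilon>"
  proof (intro exI[of _ "min d1 d2"] conjI allI impI)
    fix n :: nat and a b :: "nat \<Rightarrow> real"
    assume ab: "\<forall>i<n. a i \<le> b i \<and> {a i..b i} \<subseteq> S"
      and dis: "disjoint_family_on (\<lambda>i. {a i<..<b i}) {..<n}"
      and len: "(\<Sum>i<n. b i - a i) < min d1 d2"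
    have "norm (h (b i) - h (a i)) \<le> K * (norm (f (b i) - f (a i)) + norm (g (b i) - g (a i)))"
      if "i < n" for i
    proof -
      have "a i \<in> {a i..b i}" "b i \<in> {a i..b i}" "{a i..b i} \<subseteq> S" using ab that by auto
      then have "a i \<in> S" "b i \<in> S" by blast+
      then have "norm (h (b i) - h (a i)) \<le> M * (norm (f (b i) - f (a i)) + norm (g (b i) - g (a i)))"
        by (rule h)
      also have "\<dots> \<le> K * (norm (f (b i) - f (a i)) + norm (g (b i) - g (a i)))"
        using K by (intro mult_right_mono) auto
      finally show ?thesis .
    qed
    then have "(\<Sum>i<n. norm (h (b i) - h (a i))) \<le>
        (\<Sum>i<n. K * (norm (f (b i) - f (a i)) + norm (g (b i) - g (a i))))"
      by (intro sum_mono) auto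
    also have "\<dots> = K * ((\<Sum>i<n. norm (f (b i) - f (a i))) + (\<Sum>i<n. norm (g (b i) - g (a i))))"
      by (simp only: sum.distrib flip: sum_distrib_left)
    also have "\<dots> < K * (e + e)"
      using K D1[OF ab dis] D2[OF ab dis] len by (intro mult_strict_left_mono add_strict_mono) auto
    also have "\<dots> = \<epsilon>" using K by (simp add: e_def)
    finally show "(\<Sum>i<n. norm (h (b i) - h (a i))) < \<epsilon>" .
  qed (use d1 d2 in auto)
qed

lemma abs_cont_on_ident: "abs_cont_on S (\<lambda>x. x)"
  unfolding abs_cont_on_def
proof (intro allI impI)
  fix \<epsilon> :: real assume "\<epsilon> > 0"
  then show "\<exists>\<delta>>0. \<forall>(n::nat) a b. (\<forall>i<n. a i \<le> b i \<and> {a i..b i} \<subseteq> S) \<longrightarrow>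
      disjoint_family_on (\<lambda>i. {a i<..<b i}) {..<n} \<longrightarrow> (\<Sum>i<n. b i - a i) < \<delta> \<longrightarrow>
      (\<Sum>i<n. norm (b i - a i)) < \<epsilon>"
    by (intro exI[of _ \<epsilon>]) auto
qed

lemma abs_cont_on_cong:
  assumes "abs_cont_on S f" "\<And>x. x \<in> S \<Longrightarrow> f x = g x"
  shows "abs_cont_on S g"
  by (rule abs_cont_on_dominated[OF assms(1) assms(1), of _ 1]) (simp add: assms(2))

lemma lipschitz_on_imp_abs_cont_on:
  assumes "L-lipschitz_on S f"
  shows "abs_cont_on S f"
proof (rule abs_cont_on_dominated[OF abs_cont_on_ident abs_cont_on_ident, of _ _ L])
  fix x y assume "x \<in> S" "y \<in> S"
  then have "norm (f y - f x) \<le> L * norm (y - x)"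
    using lipschitz_onD[OF assms, of y x] by (simp add: dist_norm)
  also have "\<dots> \<le> L * (norm (y - x) + norm (y - x))"
    using lipschitz_on_nonneg[OF assms] by (intro mult_left_mono) auto
  finally show "norm (f y - f x) \<le> L * (norm (y - x) + norm (y - x))" .
qed

lemma abs_cont_on_diff:
  assumes "abs_cont_on S f" "abs_cont_on S g"
  shows "abs_cont_on S (\<lambda>x. f x - g x)"
proof (rule abs_cont_on_dominated[OF assms, of _ 1])
  fix x y
  have "(f y - g y) - (f x - g x) = (f y - f x) - (g y - g x)" by simp
  then show "norm ((f y - g y) - (f x - g x)) \<le> 1 * (norm (f y - f x) + norm (g y - g x))"
    by (metis mult_1 norm_triangle_ineq4)
qed

lemma abs_cont_on_of_real:
  assumes "abs_cont_on S f"
  shows "abs_cont_on S (\<lambda>x. of_real (f x) :: complex)"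
  by (rule abs_cont_on_dominated[OF assms assms, of _ 1]) (simp flip: of_real_diff)

lemma abs_cont_on_imp_uniformly_continuous_on:
  fixes f :: "real \<Rightarrow> 'a::real_normed_vector"
  assumes f: "abs_cont_on S f" and S: "is_interval S"
  shows "uniformly_continuous_on S f"
  unfolding uniformly_continuous_on_def
proof (intro allI impI)
  fix \<epsilon> :: real assume "\<epsilon> > 0"
  then obtain \<delta> where \<delta>: "\<delta> > 0" and D: "\<And>(n::nat) a b. (\<forall>i<n. a i \<le> b i \<and> {a i..b i} \<subseteq> S) \<Longrightarrow>
      disjoint_family_on (\<lambda>i. {a i<..<b i}) {..<n} \<Longrightarrow> (\<Sum>i<n. b i - a i) < \<delta> \<Longrightarrow>
      (\<Sum>i<n. norm (f (b i) - f (a i))) < \<epsilon>"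
    using f unfolding abs_cont_on_def by meson
  have *: "dist (f y) (f x) < \<epsilon>" if "x \<in> S" "y \<in> S" "x \<le> y" "y - x < \<delta>" for x y
  proof -
    have "{x..y} \<subseteq> S"
      using S that(1,2) unfolding is_interval_1 by (meson atLeastAtMost_iff subsetI)
    then show ?thesis
      using D[of 1 "\<lambda>_. x" "\<lambda>_. y"] that by (simp add: disjoint_family_on_def dist_norm)
  qed
  show "\<exists>d>0. \<forall>x\<in>S. \<forall>x'\<in>S. dist x' x < d \<longrightarrow> dist (f x') (f x) < \<epsilon>"
  proof (intro exI[of _ \<delta>] conjI ballI impI)
    fix x x' assume "x \<in> S" "x' \<in> S" "dist x' x < \<delta>"
    then show "dist (f x') (f x) < \<epsilon>"
      using *[of x x'] *[of x' x] by (cases "x \<le> x'") (auto simp: dist_norm norm_minus_commute)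
  qed (use \<delta> in auto)
qed

text \<open>
  The interval may be open, as it is for the derivative of an eigenfunction on either side of \<open>t\<close>.
\<close>

lemma abs_cont_on_imp_bounded:
  fixes f :: "real \<Rightarrow> 'a::{real_normed_vector, heine_borel}"
  assumes "abs_cont_on S f" "is_interval S" "bounded S"
  shows "bounded (f ` S)"
  using abs_cont_on_imp_uniformly_continuous_on[OF assms(1,2)] assms(3)
  by (rule bounded_uniformly_continuous_image)

lemma abs_cont_on_mult:
  fixes f g :: "real \<Rightarrow> 'a::{real_normed_algebra, heine_borel}"
  assumes f: "abs_cont_on S f" and g: "abs_cont_on S g" and S: "is_interval S" "bounded S"
  shows "abs_cont_on S (\<lambda>x. f x * g x)"
proof -
  obtain A where A: "\<And>x. x \<in> S \<Longrightarrow> norm (f x) \<le> A"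
    using abs_cont_on_imp_bounded[OF f S] by (auto simp: bounded_iff)
  obtain B where B: "\<And>x. x \<in> S \<Longrightarrow> norm (g x) \<le> B"
    using abs_cont_on_imp_bounded[OF g S] by (auto simp: bounded_iff)
  show ?thesis
  proof (rule abs_cont_on_dominated[OF f g, of _ "max A B"])
    fix x y assume xy: "x \<in> S" "y \<in> S"
    have "f y * g y - f x * g x = (f y - f x) * g y + f x * (g y - g x)"
      by (simp add: algebra_simps)
    then have "norm (f y * g y - f x * g x) \<le> norm (f y - f x) * norm (g y) + norm (f x) * norm (g y - g x)"
      by (metis norm_triangle_le add_mono norm_mult_ineq)
    also have "\<dots> \<le> norm (f y - f x) * max A B + max A B * norm (g y - g x)"
      using A[OF xy(1)] B[OF xy(2)] by (intro add_mono mult_left_mono mult_right_mono) auto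
    finally show "norm (f y * g y - f x * g x) \<le> max A B * (norm (f y - f x) + norm (g y - g x))"
      by (simp add: algebra_simps)
  qed
qed

text \<open>
  The definition numbers its intervals; the intervals of a tagged division come as a finite set.
\<close>

lemma abs_cont_onD_finite:
  fixes f :: "real \<Rightarrow> 'a::real_normed_vector"
  assumes "abs_cont_on S f" "\<epsilon> > 0"
  obtains \<delta> where "\<delta> > 0"
    "\<And>(I::'i set) a b. finite I \<Longrightarrow> (\<And>i. i \<in> I \<Longrightarrow> a i \<le> b i \<and> {a i..b i} \<subseteq> S) \<Longrightarrow>
      disjoint_family_on (\<lambda>i. {a i<..<b i}) I \<Longrightarrow> (\<Sum>i\<in>I. b i - a i) < \<delta> \<Longrightarrow>
      (\<Sum>i\<in>I. norm (f (b i) - f (a i))) < \<epsilon>"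
proof -
  obtain \<delta> where \<delta>: "\<delta> > 0" and D: "\<And>(n::nat) a b. (\<forall>i<n. a i \<le> b i \<and> {a i..b i} \<subseteq> S) \<Longrightarrow>
      disjoint_family_on (\<lambda>i. {a i<..<b i}) {..<n} \<Longrightarrow> (\<Sum>i<n. b i - a i) < \<delta> \<Longrightarrow>
      (\<Sum>i<n. norm (f (b i) - f (a i))) < \<epsilon>"
    using assms unfolding abs_cont_on_def by meson
  show thesis
  proof (rule that[OF \<delta>])
    fix I :: "'i set" and a b
    assume "finite I" and ab: "\<And>i. i \<in> I \<Longrightarrow> a i \<le> b i \<and> {a i..b i} \<subseteq> S"
      and dis: "disjoint_family_on (\<lambda>i. {a i<..<b i}) I" and len: "(\<Sum>i\<in>I. b i - a i) < \<delta>"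
    obtain h where h: "bij_betw h {..<card I} I"
      using ex_bij_betw_nat_finite[OF \<open>finite I\<close>] by (auto simp: atLeast0LessThan)
    have re: "(\<Sum>i\<in>I. F i) = (\<Sum>k<card I. F (h k))" for F :: "'i \<Rightarrow> real"
      using sum.reindex_bij_betw[OF h] by metis
    have hI: "h k \<in> I" if "k < card I" for k
      using h that by (auto simp: bij_betw_def)
    have "(\<Sum>k<card I. norm (f (b (h k)) - f (a (h k)))) < \<epsilon>"
    proof (rule D)
      show "disjoint_family_on (\<lambda>k. {a (h k)<..<b (h k)}) {..<card I}"
        using dis h unfolding disjoint_family_on_def bij_betw_def inj_on_def
        by (metis hI lessThan_iff)
    qed (use ab hI len re in auto)
    then show "(\<Sum>i\<in>I. norm (f (b i) - f (a i))) < \<epsilon>" by (simp add: re)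
  qed
qed

lemma abs_cont_on_compose_lipschitz:
  assumes "abs_cont_on S f" "L-lipschitz_on (f ` S) g"
  shows "abs_cont_on S (\<lambda>x. g (f x))"
proof (rule abs_cont_on_dominated[OF assms(1) assms(1), of _ L])
  fix x y assume "x \<in> S" "y \<in> S"
  then have "norm (g (f y) - g (f x)) \<le> L * norm (f y - f x)"
    using lipschitz_onD[OF assms(2), of "f y" "f x"] by (simp add: dist_norm)
  also have "\<dots> \<le> L * (norm (f y - f x) + norm (f y - f x))"
    using lipschitz_on_nonneg[OF assms(2)] by (intro mult_left_mono) auto
  finally show "norm (g (f y) - g (f x)) \<le> L * (norm (f y - f x) + norm (f y - f x))" .
qed

lemma C1_imp_lipschitz_on:
  fixes f :: "real \<Rightarrow> 'a::real_normed_vector"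
  assumes der: "\<And>x. x \<in> {a..b} \<Longrightarrow> (f has_vector_derivative f' x) (at x within {a..b})"
    and cont: "continuous_on {a..b} f'"
  obtains L where "L-lipschitz_on {a..b} f"
proof -
  have "compact (f' ` {a..b})" by (intro compact_continuous_image cont) simp
  then obtain C where C: "C > 0" "\<And>x. x \<in> {a..b} \<Longrightarrow> norm (f' x) \<le> C"
    using bounded_pos[of "f' ` {a..b}"] compact_imp_bounded by auto
  have "C-lipschitz_on {a..b} f"
  proof (rule bounded_derivative_imp_lipschitz)
    show "(f has_derivative (\<lambda>h. h *\<^sub>R f' x)) (at x within {a..b})" if "x \<in> {a..b}" for x
      using der[OF that] by (simp add: has_vector_derivative_def)
    show "onorm (\<lambda>h. h *\<^sub>R f' x) \<le> C" if "x \<in> {a..b}" for x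
      using C(2)[OF that] by (intro onorm_le) (simp add: mult.commute[of C] mult_left_mono)
  qed (use C in auto)
  then show thesis by (rule that)
qed

text \<open>
  A gauge argument replaces the usual covering theorem.  Choose a fine tagged division of \<open>[a,b]\<close>.
  Where the tag has zero derivative, the increment of \<open>f\<close> is at most \<open>e\<close> times the length.  The
  remaining intervals have tags in the null set and lie in an open set \<open>U\<close> of measure less than
  \<open>\<delta>\<close>, so absolute continuity bounds the sum of their increments.
\<close>

lemma abs_cont_on_const_endpoints:
  fixes f :: "real \<Rightarrow> 'a::real_normed_vector"
  assumes f: "abs_cont_on {a..b} f" and "a \<le> b" and N: "negligible N"
    and der: "\<And>x. x \<in> {a<..<b} - N \<Longrightarrow> (f has_vector_derivative 0) (at x)"
  shows "f b = f a"
proof -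
  have "norm (f b - f a) \<le> \<epsilon>" if "\<epsilon> > 0" for \<epsilon>
  proof -
    \<comment> \<open>The end points join the null set, so that every other tag has a two-sided derivative.\<close>
    define Z where "Z = N \<union> {a, b}"
    have Z: "Z \<in> sets lebesgue" "emeasure lebesgue Z = 0"
    proof -
      have "negligible Z" using N by (simp add: Z_def)
      then show "Z \<in> sets lebesgue" "emeasure lebesgue Z = 0"
        by (auto simp: negligible_iff_null_sets)
    qed
    define c where "c = b - a + 1"
    have c: "c > 0" "b - a \<le> c" using \<open>a \<le> b\<close> by (auto simp: c_def)
    define e where "e = \<epsilon> / (2 * c)"
    have e: "e > 0" using that c by (simp add: e_def)
    obtain \<delta> where \<delta>: "\<delta> > 0"
      and D: "\<And>(I::(real \<times> real set) set) l u. finite I \<Longrightarrow> (\<And>i. i \<in> I \<Longrightarrow> l i \<le> u i \<and> {l i..u i} \<subseteq> {a..b}) \<Longrightarrow>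
      disjoint_family_on (\<lambda>i. {l i<..<u i}) I \<Longrightarrow> (\<Sum>i\<in>I. u i - l i) < \<delta> \<Longrightarrow>
      (\<Sum>i\<in>I. norm (f (u i) - f (l i))) < \<epsilon> / 2"
      by (rule abs_cont_onD_finite[OF f half_gt_zero[OF \<open>\<epsilon> > 0\<close>]]) blast
    obtain U where U: "open U" "Z \<subseteq> U" "U - Z \<in> lmeasurable" "emeasure lebesgue (U - Z) < ennreal \<delta>"
      using sets_lebesgue_outer_open[OF Z(1) \<delta>] by metis
    have "\<exists>r>0. (x \<in> Z \<longrightarrow> ball x r \<subseteq> U) \<and>
        (x \<in> {a..b} - Z \<longrightarrow> (\<forall>y\<in>ball x r. norm (f y - f x) \<le> e * \<bar>y - x\<bar>))" for x
    proof (cases "x \<in> Z")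
      case True
      then show ?thesis using U by (meson DiffD2 open_contains_ball subsetD)
    next
      case False
      show ?thesis
      proof (cases "x \<in> {a..b}")
        case True
        with False have "(f has_vector_derivative 0) (at x)" by (intro der) (auto simp: Z_def)
        then obtain r where "r > 0" "\<And>y. norm (y - x) < r \<Longrightarrow> norm (f y - f x - (y - x) *\<^sub>R 0) \<le> e * norm (y - x)"
          unfolding has_vector_derivative_def has_derivative_at_alt using e by blast
        then show ?thesis using False
          by (intro exI[of _ r]) (auto simp: dist_norm norm_minus_commute)
      qed (use False in \<open>auto intro: exI[of _ 1]\<close>)
    qed
    then obtain r where r: "\<And>x. r x > 0" "\<And>x. x \<in> Z \<Longrightarrow> ball x (r x) \<subseteq> U"
        "\<And>x y. x \<in> {a..b} - Z \<Longrightarrow> y \<in> ball x (r x) \<Longrightarrow> norm (f y - f x) \<le> e * \<bar>y - x\<bar>"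
      by metis
    have "gauge (\<lambda>x. ball x (r x))" using r(1) by (rule gauge_ball_dependent[rule_format])
    then obtain p where p: "p tagged_division_of {a..b}" and fine: "(\<lambda>x. ball x (r x)) fine p"
      by (rule fine_division_exists_real)
    have finp: "finite p" using p by (rule tagged_division_of_finite)
    have K: "Inf K \<le> Sup K \<and> K = {Inf K..Sup K} \<and> x \<in> K \<and> K \<subseteq> {a..b} \<and> K \<subseteq> ball x (r x)"
      if "(x, K) \<in> p" for x K
    proof -
      have 1: "x \<in> K" "K \<subseteq> {a..b}" "\<exists>u v. K = cbox u v"
        using tagged_division_ofD(2,3,4)[OF p that] by auto
      then obtain u v where "K = {u..v}" by auto
      moreover have "u \<le> v" using 1 calculation by auto
      ultimately show ?thesis using 1 fineD[OF fine that] by auto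
    qed
    let ?d = "\<lambda>(x,K). f (Sup K) - f (Inf K)"
    define P where "P = {i\<in>p. fst i \<in> Z}"
    have dis: "disjoint_family_on (\<lambda>i. {Inf (snd i)<..<Sup (snd i)}) p"
      unfolding disjoint_family_on_def
    proof (intro ballI impI)
      fix i j assume ij: "i \<in> p" "j \<in> p" "i \<noteq> j"
      have "interior (snd i) \<inter> interior (snd j) = {}"
        using tagged_division_ofD(5)[OF p, of "fst i" "snd i" "fst j" "snd j"] ij by auto
      moreover have "interior (snd l) = {Inf (snd l)<..<Sup (snd l)}" if "l \<in> p" for l
        using K[of "fst l" "snd l"] that by (metis (no_types) interior_atLeastAtMost_real prod.collapse)
      ultimately show "{Inf (snd i)<..<Sup (snd i)} \<inter> {Inf (snd j)<..<Sup (snd j)} = {}"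
        using ij by auto
    qed
    have PU: "(\<Sum>i\<in>P. Sup (snd i) - Inf (snd i)) < \<delta>"
    proof -
      let ?I = "\<lambda>i. {Inf (snd i)<..<Sup (snd i)} :: real set"
      have le: "Inf (snd i) \<le> Sup (snd i)" "?I i \<subseteq> U" if "i \<in> P" for i
      proof -
        have i: "(fst i, snd i) \<in> p" "fst i \<in> Z" using that by (auto simp: P_def)
        show "Inf (snd i) \<le> Sup (snd i)" using K[OF i(1)] by simp
        have "?I i \<subseteq> {Inf (snd i)..Sup (snd i)}" by auto
        also have "\<dots> \<subseteq> U" using K[OF i(1)] r(2)[OF i(2)] by (metis order_trans)
        finally show "?I i \<subseteq> U" .
      qed
      have "ennreal (\<Sum>i\<in>P. Sup (snd i) - Inf (snd i)) = (\<Sum>i\<in>P. emeasure lebesgue (?I i))"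
        using le by (simp add: sum_ennreal)
      also have "\<dots> = emeasure lebesgue (\<Union>i\<in>P. ?I i)"
        using dis finp by (intro sum_emeasure) (auto simp: P_def disjoint_family_on_def)
      also have "\<dots> \<le> emeasure lebesgue ((U - Z) \<union> Z)"
      proof (rule emeasure_mono)
        show "(\<Union>i\<in>P. ?I i) \<subseteq> (U - Z) \<union> Z" using le(2) by blast
        show "(U - Z) \<union> Z \<in> sets lebesgue" using Z U by (intro sets.Un) auto
      qed
      also have "\<dots> \<le> emeasure lebesgue (U - Z) + emeasure lebesgue Z"
        using U Z by (intro emeasure_subadditive) auto
      also have "\<dots> < ennreal \<delta>" using Z U by simp
      finally show ?thesis
        using le \<delta> by (subst (asm) ennreal_less_iff) (auto intro!: sum_nonneg)
    qed
    have s1: "(\<Sum>i\<in>P. norm (f (Sup (snd i)) - f (Inf (snd i)))) < \<epsilon> / 2"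
    proof (rule D)
      show "disjoint_family_on (\<lambda>i. {Inf (snd i)<..<Sup (snd i)}) P"
        using dis by (rule disjoint_family_on_mono[rotated]) (auto simp: P_def)
      show "Inf (snd i) \<le> Sup (snd i) \<and> {Inf (snd i)..Sup (snd i)} \<subseteq> {a..b}" if "i \<in> P" for i
        using that K[of "fst i" "snd i"] by (auto simp: P_def)
    qed (use finp PU in \<open>auto simp: P_def\<close>)
    have s2: "(\<Sum>i\<in>p-P. norm (?d i)) \<le> \<epsilon> / 2"
    proof -
      have "norm (?d i) \<le> e * (case i of (x,K) \<Rightarrow> Sup K - Inf K)" if "i \<in> p - P" for i
      proof -
        obtain x K where i: "i = (x,K)" by fastforce
        with that have xK: "(x,K) \<in> p" "x \<notin> Z" by (auto simp: P_def)
        note KK = K[OF xK(1)]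
        have "Sup K \<in> {Inf K..Sup K}" "Inf K \<in> {Inf K..Sup K}" "x \<in> {Inf K..Sup K}" using KK by auto
        moreover have "{Inf K..Sup K} \<subseteq> ball x (r x)" using KK by metis
        ultimately have "x \<in> {a..b} - Z" "Sup K \<in> ball x (r x)" "Inf K \<in> ball x (r x)" "Inf K \<le> x" "x \<le> Sup K"
          using xK(2) KK by auto
        then have le: "norm (f (Sup K) - f x) \<le> e * \<bar>Sup K - x\<bar>" "norm (f (Inf K) - f x) \<le> e * \<bar>Inf K - x\<bar>"
          by (blast intro: r(3))+
        moreover have "norm (f (Sup K) - f (Inf K)) \<le> norm (f (Sup K) - f x) + norm (f (Inf K) - f x)"
          using norm_triangle_ineq4[of "f (Sup K) - f x" "f (Inf K) - f x"] by simp
        ultimately show ?thesis using \<open>Inf K \<le> x\<close> \<open>x \<le> Sup K\<close> le by (simp add: i algebra_simps)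
      qed
      then have "(\<Sum>i\<in>p-P. norm (?d i)) \<le> (\<Sum>i\<in>p-P. e * (case i of (x,K) \<Rightarrow> Sup K - Inf K))"
        by (rule sum_mono)
      also have "\<dots> \<le> (\<Sum>i\<in>p. e * (case i of (x,K) \<Rightarrow> Sup K - Inf K))"
        using finp K e by (intro sum_mono2) (auto simp: P_def)
      also have "\<dots> = e * (b - a)"
        using additive_tagged_division_1[OF \<open>a \<le> b\<close> p, of "\<lambda>x. x"] by (simp flip: sum_distrib_left)
      also have "\<dots> \<le> e * c" using e c by simp
      also have "\<dots> = \<epsilon> / 2" using c by (simp add: e_def)
      finally show ?thesis .
    qed
    have "f b - f a = sum ?d p" using additive_tagged_division_1[OF \<open>a \<le> b\<close> p, of f] by simp
    also have "norm \<dots> \<le> (\<Sum>i\<in>p. norm (?d i))" by (rule norm_sum)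
    also have "\<dots> = (\<Sum>i\<in>P. norm (?d i)) + (\<Sum>i\<in>p-P. norm (?d i))"
      using finp by (subst sum.subset_diff[of P p]) (auto simp: P_def)
    also have "\<dots> \<le> \<epsilon> / 2 + \<epsilon> / 2" using s1 s2 by (intro add_mono) (auto simp: case_prod_unfold)
    finally show ?thesis by simp
  qed
  then have "norm (f b - f a) \<le> 0" using field_le_epsilon[of "norm (f b - f a)" 0] by force
  then show ?thesis by simp
qed

section \<open>Indefinite integrals\<close>

text \<open>
  The differentiation theorem for averages over \<open>[x, x + h]\<close> yields the right derivative; applied
  to the reflected integrand \<open>f (- x)\<close> at \<open>- x\<close>, it yields the left one.
\<close>

lemma indefinite_integral_derivative_ae:
  fixes g :: "real \<Rightarrow> real"
  assumes g: "g integrable_on {a..b}"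
  obtains N where "negligible N"
    "\<And>x. x \<in> {a<..<b} - N \<Longrightarrow> ((\<lambda>x. integral {a..x} g) has_vector_derivative g x) (at x)"
proof -
  define f where "f = (\<lambda>x. if x \<in> {a..b} then g x else 0)"
  have "f integrable_on UNIV"
    unfolding f_def using g by (simp only: integrable_restrict_UNIV)
  then have f: "f integrable_on {c..d}" for c d
    by (metis integrable_on_subinterval subset_UNIV box_real(2))
  then have f': "(\<lambda>x. f (- x)) integrable_on {c..d}" for c d
    using Henstock_Kurzweil_Integration.integrable_reflect_real[where f = f and a = "-d" and b = "-c"] f by simp
  obtain N1 where N1: "negligible N1" and R: "\<And>x e. x \<notin> N1 \<Longrightarrow> 0 < e \<Longrightarrow>
      \<exists>d>0. \<forall>h. 0 < h \<and> h < d \<longrightarrow> \<bar>integral {x..x + h} f / h - f x\<bar> < e"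
    using integrable_ccontinuous_explicit[of f] f by (auto simp: divide_inverse mult.commute)
  obtain N2 where N2: "negligible N2" and L: "\<And>x e. x \<notin> N2 \<Longrightarrow> 0 < e \<Longrightarrow>
      \<exists>d>0. \<forall>h. 0 < h \<and> h < d \<longrightarrow> \<bar>integral {x..x + h} (\<lambda>x. f (- x)) / h - f (- x)\<bar> < e"
    using integrable_ccontinuous_explicit[of "\<lambda>x. f (- x)"] f' by (auto simp: divide_inverse mult.commute)
  have "negligible (uminus ` N2)"
    by (rule negligible_differentiable_image_negligible[OF order_refl N2])
       (intro differentiable_on_minus differentiable_on_ident)
  show thesis
  proof (rule that)
    show "negligible (N1 \<union> uminus ` N2)" using N1 \<open>negligible (uminus ` N2)\<close> by simp
    fix x assume x: "x \<in> {a<..<b} - (N1 \<union> uminus ` N2)"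
    then have xN: "x \<notin> N1" "- x \<notin> N2" by (auto intro: rev_image_eqI)
    have fx: "f x = g x" using x by (simp add: f_def)
    have inc: "integral {a..v} g - integral {a..u} g = integral {u..v} f" if "a \<le> u" "u \<le> v" "v \<le> b" for u v
    proof -
      have "integral {a..u} g + integral {u..v} g = integral {a..v} g"
        by (rule Henstock_Kurzweil_Integration.integral_combine)
           (use that in \<open>auto intro: integrable_on_subinterval[OF g]\<close>)
      moreover have "integral {u..v} g = integral {u..v} f"
        by (rule integral_cong) (use that in \<open>auto simp: f_def\<close>)
      ultimately show ?thesis by simp
    qed
    show "((\<lambda>x. integral {a..x} g) has_vector_derivative g x) (at x)"
      unfolding has_vector_derivative_def has_derivative_at_alt
    proof (intro conjI allI impI)
      fix e :: real assume "e > 0"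
      obtain d1 where d1: "d1 > 0" "\<And>h. 0 < h \<Longrightarrow> h < d1 \<Longrightarrow> \<bar>integral {x..x + h} f / h - f x\<bar> < e"
        using R[OF xN(1) \<open>e > 0\<close>] by auto
      obtain d2 where d2: "d2 > 0" "\<And>h. 0 < h \<Longrightarrow> h < d2 \<Longrightarrow>
          \<bar>integral {-x..-x + h} (\<lambda>x. f (- x)) / h - f x\<bar> < e"
        using L[OF xN(2) \<open>e > 0\<close>] by auto
      define d where "d = Min {d1, d2, x - a, b - x}"
      have d: "d > 0" "d \<le> d1" "d \<le> d2" "d \<le> x - a" "d \<le> b - x"
        using d1 d2 x by (auto simp: d_def)
      have est: "\<bar>I - h * g x\<bar> \<le> e * h" if "\<bar>I / h - f x\<bar> < e" "h > 0" for I h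
      proof -
        have "I - h * g x = h * (I / h - f x)" using that fx by (simp add: field_simps)
        then have "\<bar>I - h * g x\<bar> = h * \<bar>I / h - f x\<bar>" using that by (simp add: abs_mult)
        also have "\<dots> \<le> h * e" using that by (intro mult_left_mono) auto
        finally show ?thesis by (simp add: mult.commute)
      qed
      show "\<exists>d>0. \<forall>y. norm (y - x) < d \<longrightarrow>
          norm (integral {a..y} g - integral {a..x} g - (y - x) *\<^sub>R g x) \<le> e * norm (y - x)"
      proof (intro exI[of _ d] conjI allI impI)
        fix y assume y: "norm (y - x) < d"
        consider "y = x" | "y > x" | "y < x" by linarith
        then show "norm (integral {a..y} g - integral {a..x} g - (y - x) *\<^sub>R g x) \<le> e * norm (y - x)"
        proof cases
          case 2
          then have "integral {a..y} g - integral {a..x} g = integral {x..x + (y - x)} f"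
            using inc[of x y] x d y by auto
          then show ?thesis using est[OF d1(2)[of "y - x"]] 2 y d by simp
        next
          case 3
          then have "integral {a..x} g - integral {a..y} g = integral {y..x} f"
            using inc[of y x] x d y by auto
          also have "\<dots> = integral {-x..-x + (x - y)} (\<lambda>x. f (- x))"
            using Henstock_Kurzweil_Integration.integral_reflect_real[where f = f and a = y and b = x] by simp
          finally have "\<bar>(integral {a..x} g - integral {a..y} g) - (x - y) * g x\<bar> \<le> e * (x - y)"
            using est[OF d2(2)[of "x - y"]] 3 y d by simp
          then show ?thesis using 3 by (simp add: abs_if algebra_simps split: if_splits)
        qed simp
      qed (use d in auto)
    qed (rule bounded_linear_scaleR_left)
  qed
qed

text \<open>
  Split \<open>\<bar>g\<bar>\<close> at a height \<open>n\<close>.  The part above \<open>n\<close> has a small integral by dominated convergence, and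
  the part below contributes at most \<open>n\<close> times the total length of the intervals.
\<close>

lemma abs_cont_on_indefinite_integral:
  fixes g :: "real \<Rightarrow> real"
  assumes g: "g absolutely_integrable_on {a..b}"
  shows "abs_cont_on {a..b} (\<lambda>x. integral {a..x} g)"
  unfolding abs_cont_on_def
proof (intro allI impI)
  fix \<epsilon> :: real assume "\<epsilon> > 0"
  define h where "h = (\<lambda>n x. \<bar>g x\<bar> - min \<bar>g x\<bar> (real n))"
  have ai: "(\<lambda>x. \<bar>g x\<bar>) absolutely_integrable_on {a..b}"
    using absolutely_integrable_norm[OF g] by (simp add: o_def)
  have mn: "(\<lambda>x. min \<bar>g x\<bar> (real n)) absolutely_integrable_on {a..b}" for n
    by (rule absolutely_integrable_min_1[OF ai]) auto
  have gabs: "g integrable_on {a..b}" "(\<lambda>x. \<bar>g x\<bar>) integrable_on {a..b}"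
    using g ai by (simp_all add: absolutely_integrable_on_def)
  have hai: "h n absolutely_integrable_on {a..b}" for n
    unfolding h_def by (rule set_integral_diff(1)[OF ai mn])
  then have hi: "h n integrable_on {a..b}" for n
    by (simp add: absolutely_integrable_on_def)
  have "(\<lambda>n. integral {a..b} (h n)) \<longlonglongrightarrow> integral {a..b} (\<lambda>x. 0)"
  proof (rule dominated_convergence(2)[where h = "\<lambda>x. \<bar>g x\<bar>"])
    show "(\<lambda>n. h n x) \<longlonglongrightarrow> 0" for x
    proof (rule tendsto_eventually)
      show "\<forall>\<^sub>F n in sequentially. h n x = 0"
        using eventually_ge_at_top[of "nat \<lceil>\<bar>g x\<bar>\<rceil>"]
        by eventually_elim (simp add: h_def min_def nat_le_iff ceiling_le_iff)
    qed
  qed (use hi ai in \<open>auto simp: h_def absolutely_integrable_on_def\<close>)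
  then have "\<forall>\<^sub>F n in sequentially. integral {a..b} (h n) < \<epsilon> / 2"
    using \<open>\<epsilon> > 0\<close> by (intro order_tendstoD(2)) auto
  then obtain n where n: "integral {a..b} (h n) < \<epsilon> / 2"
    by (meson eventually_sequentially order_refl)
  define d where "d = \<epsilon> / (2 * (real n + 1))"
  have d: "d > 0" using \<open>\<epsilon> > 0\<close> by (simp add: d_def)
  show "\<exists>\<delta>>0. \<forall>(m::nat) u v. (\<forall>i<m. u i \<le> v i \<and> {u i..v i} \<subseteq> {a..b}) \<longrightarrow>
      disjoint_family_on (\<lambda>i. {u i<..<v i}) {..<m} \<longrightarrow> (\<Sum>i<m. v i - u i) < \<delta> \<longrightarrow>
      (\<Sum>i<m. norm (integral {a..v i} g - integral {a..u i} g)) < \<epsilon>"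
  proof (intro exI[of _ d] conjI allI impI)
    fix m :: nat and u v :: "nat \<Rightarrow> real"
    assume uv: "\<forall>i<m. u i \<le> v i \<and> {u i..v i} \<subseteq> {a..b}"
      and dis: "disjoint_family_on (\<lambda>i. {u i<..<v i}) {..<m}"
      and len: "(\<Sum>i<m. v i - u i) < d"
    have one: "norm (integral {a..v i} g - integral {a..u i} g) \<le> integral {u i<..<v i} (h n) + real n * (v i - u i)"
      if "i < m" for i
    proof -
      have i: "a \<le> u i" "u i \<le> v i" "v i \<le> b" using uv that by auto
      have gi: "g integrable_on {c..e}" "(\<lambda>x. \<bar>g x\<bar>) integrable_on {c..e}" "h n integrable_on {c..e}"
        if "a \<le> c" "e \<le> b" for c e
      proof -
        have "{c..e} \<subseteq> {a..b}" using that by auto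
        then show "g integrable_on {c..e}" "(\<lambda>x. \<bar>g x\<bar>) integrable_on {c..e}" "h n integrable_on {c..e}"
          using gabs hi by (blast intro: integrable_on_subinterval)+
      qed
      have "integral {a..u i} g + integral {u i..v i} g = integral {a..v i} g"
        by (rule Henstock_Kurzweil_Integration.integral_combine) (use i in \<open>auto intro: gi\<close>)
      then have "norm (integral {a..v i} g - integral {a..u i} g) = norm (integral {u i..v i} g)" by (simp add: algebra_simps)
      also have "\<dots> \<le> integral {u i..v i} (\<lambda>x. \<bar>g x\<bar>)"
        by (rule integral_norm_bound_integral) (use i in \<open>auto intro: gi\<close>)
      also have "\<dots> \<le> integral {u i..v i} (\<lambda>x. h n x + real n)"
      proof (rule integral_le)
        show "(\<lambda>x. h n x + real n) integrable_on {u i..v i}"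
          using i by (intro integrable_add gi) auto
      qed (use i in \<open>auto intro!: gi simp: h_def\<close>)
      also have "\<dots> = integral {u i..v i} (h n) + real n * (v i - u i)"
        using i by (subst integral_add) (auto intro: gi)
      finally show ?thesis by (simp add: integral_open_interval_real)
    qed
    have pos: "0 \<le> h n x" for x by (simp add: h_def)
    have "((h n) has_integral (\<Sum>i<m. integral {u i<..<v i} (h n))) (\<Union>i<m. {u i<..<v i})"
    proof (rule has_integral_UN)
      show "(h n has_integral integral {u i<..<v i} (h n)) {u i<..<v i}" if "i \<in> {..<m}" for i
      proof -
        have "h n integrable_on {u i..v i}"
          by (rule integrable_on_subinterval[OF hi]) (use uv that in auto)
        then show ?thesis by (simp add: integrable_integral integrable_on_open_interval_real)
      qed
      show "pairwise (\<lambda>i j. negligible ({u i<..<v i} \<inter> {u j<..<v j})) {..<m}"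
        using dis by (auto simp: pairwise_def disjoint_family_on_def)
    qed simp
    note un = this
    have "(\<Sum>i<m. integral {u i<..<v i} (h n)) \<le> integral {a..b} (h n)"
    proof (rule has_integral_subset_le[OF _ un integrable_integral[OF hi]])
      have "{u i<..<v i} \<subseteq> {a..b}" if "i < m" for i
        using uv that greaterThanLessThan_subseteq_atLeastAtMost_iff[of "u i" "v i" a b] by auto
      then show "(\<Union>i<m. {u i<..<v i}) \<subseteq> {a..b}" by blast
    qed (use pos in blast)
    moreover have "real n * (\<Sum>i<m. v i - u i) \<le> real n * d"
      using len by (intro mult_left_mono) auto
    moreover have "real n * d < \<epsilon> / 2" using \<open>\<epsilon> > 0\<close> by (simp add: d_def field_simps)
    moreover have "(\<Sum>i<m. norm (integral {a..v i} g - integral {a..u i} g)) \<le>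
        (\<Sum>i<m. integral {u i<..<v i} (h n) + real n * (v i - u i))"
      using one by (intro sum_mono) auto
    ultimately show "(\<Sum>i<m. norm (integral {a..v i} g - integral {a..u i} g)) < \<epsilon>"
      using n by (simp add: sum.distrib flip: sum_distrib_left)
  qed (rule d)
qed

section \<open>The initial value problem\<close>

lemma absolutely_integrable_mult_continuous:
  fixes q f :: "real \<Rightarrow> real"
  assumes q: "q absolutely_integrable_on {a..b}" and f: "continuous_on {a..b} f"
  shows "(\<lambda>x. q x * f x) absolutely_integrable_on {a..b}"
    and "(\<lambda>x. q x * f x) integrable_on {a..b}"
proof -
  have "(\<lambda>x. f x * q x) absolutely_integrable_on {a..b}"
  proof (rule absolutely_integrable_bounded_measurable_product_real[OF _ _ _ q])
    show "f \<in> borel_measurable (lebesgue_on {a..b})"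
      by (rule continuous_imp_measurable_on_sets_lebesgue[OF f]) simp
    show "bounded (f ` {a..b})"
      by (intro compact_imp_bounded compact_continuous_image f) simp
  qed simp
  then show "(\<lambda>x. q x * f x) absolutely_integrable_on {a..b}" by (simp add: mult.commute)
  then show "(\<lambda>x. q x * f x) integrable_on {a..b}" by (simp add: absolutely_integrable_on_def)
qed

text \<open>
  The two sides are absolutely continuous in \<open>x\<close> and have the same derivative almost everywhere.
  The identity says that, in the norm weighted by \<open>exp (2 Q)\<close>, integration against \<open>\<bar>q\<bar>\<close> has norm at most
  \<open>1/2\<close>, however large \<open>q\<close> is.
\<close>

lemma integral_abs_mult_exp:
  fixes q :: "real \<Rightarrow> real"
  assumes q: "q absolutely_integrable_on {0..1}" and x: "x \<in> {0..1}"
  defines "Q \<equiv> (\<lambda>x. integral {0..x} (\<lambda>s. \<bar>q s\<bar>))"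
  shows "integral {0..x} (\<lambda>s. \<bar>q s\<bar> * exp (2 * Q s)) = (exp (2 * Q x) - 1) / 2"
proof -
  have aq: "(\<lambda>s. \<bar>q s\<bar>) absolutely_integrable_on {0..1}"
    using absolutely_integrable_norm[OF q] by (simp add: o_def)
  then have iq: "(\<lambda>s. \<bar>q s\<bar>) integrable_on {0..1}" by (simp add: absolutely_integrable_on_def)
  have Qc: "continuous_on {0..1} Q"
    unfolding Q_def by (rule indefinite_integral_continuous_1[OF iq])
  have Qac: "abs_cont_on {0..1} Q"
    unfolding Q_def by (rule abs_cont_on_indefinite_integral[OF aq])
  let ?f = "\<lambda>s. \<bar>q s\<bar> * exp (2 * Q s)"
  have af: "?f absolutely_integrable_on {0..1}"
    by (rule absolutely_integrable_mult_continuous(1)[OF aq]) (intro continuous_intros Qc)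
  then have if': "?f integrable_on {0..1}" by (simp add: absolutely_integrable_on_def)
  define G where "G = (\<lambda>x. exp (2 * Q x) / 2 - integral {0..x} ?f)"
  have "bounded (Q ` {0..1})" by (intro compact_imp_bounded compact_continuous_image Qc) simp
  then obtain B where B: "Q ` {0..1} \<subseteq> {-B..B}"
    unfolding bounded_iff by (metis abs_le_iff atLeastAtMost_iff minus_le_iff real_norm_def subsetI)
  obtain L where "L-lipschitz_on {-B..B} (\<lambda>u::real. exp (2 * u) / 2)"
  proof (rule C1_imp_lipschitz_on)
    show "((\<lambda>u. exp (2 * u) / 2) has_vector_derivative exp (2 * x)) (at x within {-B..B})" for x :: real
      by (auto intro!: derivative_eq_intros simp flip: has_real_derivative_iff_has_vector_derivative)
  qed (intro continuous_intros)
  then have "abs_cont_on {0..1} (\<lambda>x. exp (2 * Q x) / 2)"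
    using abs_cont_on_compose_lipschitz[OF Qac] lipschitz_on_subset[OF _ B] by blast
  then have "abs_cont_on {0..1} G"
    unfolding G_def by (rule abs_cont_on_diff) (rule abs_cont_on_indefinite_integral[OF af])
  then have Gac: "abs_cont_on {0..x} G" by (rule abs_cont_on_subset) (use x in auto)
  obtain N1 where N1: "negligible N1" "\<And>x. x \<in> {0<..<1} - N1 \<Longrightarrow> (Q has_vector_derivative \<bar>q x\<bar>) (at x)"
    unfolding Q_def by (rule indefinite_integral_derivative_ae[OF iq]) blast
  obtain N2 where N2: "negligible N2"
     "\<And>x. x \<in> {0<..<1} - N2 \<Longrightarrow> ((\<lambda>x. integral {0..x} ?f) has_vector_derivative ?f x) (at x)"
    by (rule indefinite_integral_derivative_ae[OF if']) blast
  have "G x = G 0"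
  proof (rule abs_cont_on_const_endpoints[OF Gac])
    show "negligible (N1 \<union> N2)" using N1 N2 by simp
    show "(G has_vector_derivative 0) (at y)" if "y \<in> {0<..<x} - (N1 \<union> N2)" for y
    proof -
      have "y \<in> {0<..<1} - N1" "y \<in> {0<..<1} - N2" using that x by auto
      then have d: "(Q has_real_derivative \<bar>q y\<bar>) (at y)"
          "((\<lambda>x. integral {0..x} ?f) has_real_derivative ?f y) (at y)"
        using N1(2) N2(2) by (simp_all add: has_real_derivative_iff_has_vector_derivative)
      have "(G has_real_derivative 0) (at y)"
        unfolding G_def by (rule derivative_eq_intros d refl | simp)+
      then show ?thesis by (simp add: has_real_derivative_iff_has_vector_derivative)
    qed
  qed (use x in auto)
  then show ?thesis by (simp add: G_def Q_def field_simps)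
qed

text \<open>
  The integral operator is a contraction for the norm weighted by \<open>exp (2 Q)\<close>, so one application of
  the fixed point theorem covers the whole of \<open>[0,1]\<close>.  Substituting \<open>z = exp (2 Q) g\<close> turns the
  weighted norm into the supremum norm of \<open>g\<close>, and clamping the argument to \<open>[0,1]\<close> makes \<open>g\<close> a bounded
  continuous function on the real line.
\<close>

lemma integral_equation_solution:
  fixes q :: "real \<Rightarrow> real"
  assumes q: "q absolutely_integrable_on {0..1}"
  obtains z where "continuous_on {0..1} z"
    "\<And>x. x \<in> {0..1} \<Longrightarrow> z x = \<beta> + integral {0..x} (\<lambda>s. q s * (\<alpha> + integral {0..s} z))"
proof -
  define Q where "Q = (\<lambda>x. integral {0..x} (\<lambda>s. \<bar>q s\<bar>))"
  have aq: "(\<lambda>s. \<bar>q s\<bar>) absolutely_integrable_on {0..1}"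
    using absolutely_integrable_norm[OF q] by (simp add: o_def)
  then have iq: "(\<lambda>s. \<bar>q s\<bar>) integrable_on {0..1}" by (simp add: absolutely_integrable_on_def)
  have Qc: "continuous_on {0..1} Q"
    unfolding Q_def by (rule indefinite_integral_continuous_1[OF iq])
  have Qmono: "Q r \<le> Q s" if "0 \<le> r" "r \<le> s" "s \<le> 1" for r s
    unfolding Q_def
    by (rule integral_subset_le) (use that in \<open>auto intro: integrable_on_subinterval[OF iq]\<close>)
  let ?w = "\<lambda>x. exp (2 * Q x)"
  define I where "I = (\<lambda>(g::real \<Rightarrow>\<^sub>C real) s. integral {0..s} (\<lambda>r. ?w r * apply_bcontfun g r))"
  define J where "J = (\<lambda>(g::real \<Rightarrow>\<^sub>C real) x. \<beta> + integral {0..x} (\<lambda>s. q s * (\<alpha> + I g s)))"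
  have wg: "continuous_on {0..1} (\<lambda>r. ?w r * apply_bcontfun g r)" for g
    by (intro continuous_intros Qc continuous_on_apply_bcontfun)
  have Ic: "continuous_on {0..1} (I g)" for g
    unfolding I_def by (rule indefinite_integral_continuous_1[OF integrable_continuous_real[OF wg]])
  have qI: "(\<lambda>s. q s * (\<alpha> + I g s)) integrable_on {0..1}" for g
    by (intro absolutely_integrable_mult_continuous(2)[OF q] continuous_intros Ic)
  have Jc: "continuous_on {0..1} (J g)" for g
    unfolding J_def by (intro continuous_intros indefinite_integral_continuous_1[OF qI])
  define T where "T = (\<lambda>g. Bcontfun (\<lambda>x. (\<lambda>x. exp (- (2 * Q x)) * J g x) (clamp 0 1 x)))"
  have T: "apply_bcontfun (T g) x = exp (- (2 * Q (clamp 0 1 x))) * J g (clamp 0 1 x)" for g x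
  proof -
    have c: "continuous_on (cbox 0 1) (\<lambda>x. exp (- (2 * Q x)) * J g x)"
      unfolding box_real by (intro continuous_intros Qc Jc)
    have "(\<lambda>x. (\<lambda>x. exp (- (2 * Q x)) * J g x) (clamp 0 1 x)) \<in> bcontfun"
      unfolding bcontfun_def mem_Collect_eq
    proof
      show "continuous_on UNIV (\<lambda>x. (\<lambda>x. exp (- (2 * Q x)) * J g x) (clamp 0 1 x))"
        by (rule clamp_continuous_on[OF c])
      show "bounded (range (\<lambda>x. (\<lambda>x. exp (- (2 * Q x)) * J g x) (clamp 0 1 x)))"
        by (rule clamp_bounded) (intro compact_imp_bounded compact_continuous_image c compact_cbox)
    qed
    then show ?thesis unfolding T_def by (simp add: Bcontfun_inverse)
  qed
  have contr: "dist (T g) (T h) \<le> 1/2 * dist g h" for g h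
  proof (rule dist_bound)
    fix x0 :: real
    define x where "x = clamp 0 1 x0"
    have x: "x \<in> {0..1}" using clamp_in_interval[of 0 1 x0] by (simp add: x_def)
    define d where "d = dist g h"
    have d: "d \<ge> 0" "\<bar>apply_bcontfun g r - apply_bcontfun h r\<bar> \<le> d" for r
      using dist_bounded[of g r h] by (auto simp: d_def dist_real_def)
    have sub: "f integrable_on {0..s}" if "f integrable_on {0..1}" "s \<in> {0..1}" for f :: "real \<Rightarrow> real" and s
      by (rule integrable_on_subinterval[OF that(1)]) (use that in auto)
    have Id: "\<bar>I g s - I h s\<bar> \<le> d * ?w s" if s: "s \<in> {0..1}" for s
    proof -
      note ig = sub[OF integrable_continuous_real[OF wg] s]
      have "I g s - I h s = integral {0..s} (\<lambda>r. ?w r * apply_bcontfun g r - ?w r * apply_bcontfun h r)"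
        unfolding I_def by (rule integral_diff[symmetric]) (rule ig)+
      \<comment> \<open>\<open>Q\<close> is increasing, so the weight under the integral is largest at the right end point.\<close>
      also have "norm \<dots> \<le> integral {0..s} (\<lambda>r. d * ?w s)"
      proof (rule integral_norm_bound_integral)
        show "norm (?w r * apply_bcontfun g r - ?w r * apply_bcontfun h r) \<le> d * ?w s" if "r \<in> {0..s}" for r
        proof -
          have "norm (?w r * apply_bcontfun g r - ?w r * apply_bcontfun h r)
              = ?w r * \<bar>apply_bcontfun g r - apply_bcontfun h r\<bar>"
            by (simp add: abs_mult flip: right_diff_distrib)
          also have "\<dots> \<le> ?w s * d"
            using Qmono[of r s] that s d by (intro mult_mono) auto
          finally show ?thesis by (simp add: mult.commute)
        qed
      qed (auto intro: integrable_diff ig)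
      also have "\<dots> = s * (d * ?w s)" using s by simp
      also have "\<dots> \<le> d * ?w s" using s d by (intro mult_left_le_one_le) auto
      finally show ?thesis by simp
    qed
    have Ew: "(\<lambda>s. \<bar>q s\<bar> * ?w s) integrable_on {0..1}"
      by (intro absolutely_integrable_mult_continuous(2)[OF aq] continuous_intros Qc)
    have "J g x - J h x = integral {0..x} (\<lambda>s. q s * (\<alpha> + I g s) - q s * (\<alpha> + I h s))"
      unfolding J_def using sub[OF qI x] by (simp add: integral_diff)
    also have "norm \<dots> \<le> integral {0..x} (\<lambda>s. d * (\<bar>q s\<bar> * ?w s))"
    proof (rule integral_norm_bound_integral)
      show "norm (q s * (\<alpha> + I g s) - q s * (\<alpha> + I h s)) \<le> d * (\<bar>q s\<bar> * ?w s)" if "s \<in> {0..x}" for s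
      proof -
        have "norm (q s * (\<alpha> + I g s) - q s * (\<alpha> + I h s)) = \<bar>q s\<bar> * \<bar>I g s - I h s\<bar>"
          by (simp add: abs_mult flip: right_diff_distrib)
        also have "\<dots> \<le> \<bar>q s\<bar> * (d * ?w s)"
          using Id[of s] that x by (intro mult_left_mono) auto
        finally show ?thesis by (simp add: mult_ac)
      qed
    qed (rule integrable_diff[OF sub[OF qI x] sub[OF qI x]] integrable_on_mult_right[OF sub[OF Ew x]])+
    also have "\<dots> = d * integral {0..x} (\<lambda>s. \<bar>q s\<bar> * ?w s)" by simp
    also have "\<dots> = d * ((?w x - 1) / 2)"
      using integral_abs_mult_exp[OF q x] by (simp add: Q_def)
    also have "\<dots> \<le> d * (?w x / 2)" using d by (intro mult_left_mono) auto
    finally have J: "\<bar>J g x - J h x\<bar> \<le> d * (?w x / 2)" by simp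
    have "dist (apply_bcontfun (T g) x0) (apply_bcontfun (T h) x0) = exp (- (2 * Q x)) * \<bar>J g x - J h x\<bar>"
      by (simp add: T dist_real_def abs_mult flip: right_diff_distrib x_def)
    also have "\<dots> \<le> exp (- (2 * Q x)) * (d * (?w x / 2))"
      by (rule mult_left_mono[OF J]) simp
    also have "\<dots> = d / 2" by (simp add: exp_minus)
    finally show "dist (apply_bcontfun (T g) x0) (apply_bcontfun (T h) x0) \<le> 1/2 * dist g h"
      by (simp add: d_def)
  qed
  obtain g where g: "T g = g"
    using banach_fix_type[of "1/2" T] contr by auto
  define z where "z = (\<lambda>x. ?w x * apply_bcontfun g x)"
  have zJ: "z x = J g x" if "x \<in> {0..1}" for x
  proof -
    have "clamp 0 1 x = x" using that by (intro clamp_cancel_cbox) simp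
    then have "apply_bcontfun g x = exp (- (2 * Q x)) * J g x" using T[of g x] g by simp
    then show ?thesis by (simp add: z_def exp_minus)
  qed
  have "I g = (\<lambda>s. integral {0..s} z)" by (simp add: I_def z_def)
  then show thesis
    using that[of z] wg[of g] zJ unfolding J_def by (simp add: z_def)
qed

text \<open>
  Solutions of \<open>-y'' + q y = 0\<close>.  Naming the derivative and the exceptional null set allows
  differentiation rules to be applied pointwise to expressions in several solutions.
\<close>

definition real_solution ::
    "(real \<Rightarrow> real) \<Rightarrow> (real \<Rightarrow> real) \<Rightarrow> (real \<Rightarrow> real) \<Rightarrow> real set \<Rightarrow> bool" where
  "real_solution q y y' N \<longleftrightarrow>
    (\<forall>x\<in>{0..1}. (y has_vector_derivative y' x) (at x within {0..1})) \<and>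
    abs_cont_on {0..1} y' \<and> negligible N \<and>
    (\<forall>x\<in>{0<..<1} - N. (y' has_vector_derivative q x * y x) (at x))"

text \<open>
  In integrated form the problem reads \<open>y = \<alpha> + \<integral> z\<close>, \<open>z = \<beta> + \<integral> q y\<close>.
\<close>

lemma initial_value_problem:
  fixes q :: "real \<Rightarrow> real" and \<alpha> \<beta> :: real
  assumes q: "q absolutely_integrable_on {0..1}"
  obtains y z N where "y 0 = \<alpha>" "z 0 = \<beta>" "real_solution q y z N"
proof -
  obtain z where zc: "continuous_on {0..1} z" and
    z: "\<And>x. x \<in> {0..1} \<Longrightarrow> z x = \<beta> + integral {0..x} (\<lambda>s. q s * (\<alpha> + integral {0..s} z))"
    using integral_equation_solution[OF q] by metis
  define y where "y = (\<lambda>x. \<alpha> + integral {0..x} z)"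
  have zy: "z x = \<beta> + integral {0..x} (\<lambda>s. q s * y s)" if "x \<in> {0..1}" for x
    using z[OF that] by (simp add: y_def)
  have yd: "(y has_vector_derivative z x) (at x within {0..1})" if "x \<in> {0..1}" for x
    unfolding y_def using integral_has_vector_derivative[OF zc that] by (auto intro!: derivative_eq_intros)
  then have yc: "continuous_on {0..1} y"
    by (meson continuous_on_eq_continuous_within has_vector_derivative_continuous)
  have a: "(\<lambda>s. q s * y s) absolutely_integrable_on {0..1}"
    by (rule absolutely_integrable_mult_continuous(1)[OF q yc])
  then have i: "(\<lambda>s. q s * y s) integrable_on {0..1}" by (simp add: absolutely_integrable_on_def)
  have zac: "abs_cont_on {0..1} z"
    by (rule abs_cont_on_dominated[OF abs_cont_on_indefinite_integral[OF a] abs_cont_on_indefinite_integral[OF a], of _ 1])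
       (simp add: zy)
  obtain N where N: "negligible N"
     "\<And>x. x \<in> {0<..<1} - N \<Longrightarrow> ((\<lambda>x. integral {0..x} (\<lambda>s. q s * y s)) has_vector_derivative q x * y x) (at x)"
    by (rule indefinite_integral_derivative_ae[OF i]) blast
  have zd: "(z has_vector_derivative q x * y x) (at x)" if x: "x \<in> {0<..<1} - N" for x
  proof (rule has_vector_derivative_transform_within_open)
    show "((\<lambda>x. \<beta> + integral {0..x} (\<lambda>s. q s * y s)) has_vector_derivative q x * y x) (at x)"
      using N(2)[OF x] by (auto intro!: derivative_eq_intros)
    show "\<beta> + integral {0..v} (\<lambda>s. q s * y s) = z v" if "v \<in> {0<..<1}" for v
      using zy[of v] that by simp
  qed (use x in auto)
  show thesis
    by (rule that[of y z N]) (use yd zac N(1) zd in \<open>auto simp: real_solution_def y_def zy\<close>)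
qed

section \<open>Solutions that satisfy the Dirichlet condition at one end\<close>

lemma AE_lebesgueI:
  assumes "negligible N" "\<And>x. x \<notin> N \<Longrightarrow> P x"
  shows "AE x in lebesgue. P x"
  by (rule AE_I'[of N]) (use assms in \<open>auto simp: negligible_iff_null_sets\<close>)

lemma AE_lebesgueE:
  assumes "AE x in lebesgue. P x"
  obtains N where "negligible N" "\<And>x. x \<notin> N \<Longrightarrow> P x"
  using assms by (auto simp: eventually_ae_filter negligible_iff_null_sets subset_eq)

lemma real_solution_continuous:
  assumes "real_solution q y y' N"
  shows "continuous_on {0..1} y" "continuous_on {0..1} y'"
proof -
  show "continuous_on {0..1} y"
    using assms unfolding real_solution_def
    by (meson continuous_on_eq_continuous_within has_vector_derivative_continuous)
  show "continuous_on {0..1} y'"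
    using assms unfolding real_solution_def
    by (meson abs_cont_on_imp_uniformly_continuous_on uniformly_continuous_imp_continuous is_interval_cc)
qed

lemma real_solution_lipschitz:
  assumes "real_solution q y y' N"
  obtains L where "L-lipschitz_on {0..1} y"
  using C1_imp_lipschitz_on[of 0 1 y y'] assms real_solution_continuous[OF assms]
  unfolding real_solution_def by blast

lemma real_solution_abs_cont:
  assumes "real_solution q y y' N"
  shows "abs_cont_on {0..1} y" "abs_cont_on {0..1} y'"
proof -
  obtain L where "L-lipschitz_on {0..1} y" by (rule real_solution_lipschitz[OF assms])
  then show "abs_cont_on {0..1} y" by (rule lipschitz_on_imp_abs_cont_on)
  show "abs_cont_on {0..1} y'" using assms by (simp add: real_solution_def)
qed

lemma real_solution_deriv:
  assumes "real_solution q y y' N" "x \<in> {0<..<1}"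
  shows "(y has_real_derivative y' x) (at x)"
proof -
  have "(y has_vector_derivative y' x) (at x within {0..1})"
    using assms unfolding real_solution_def by auto
  moreover have "at x within {0..1} = at x"
    using assms(2) by (intro at_within_interior) auto
  ultimately show ?thesis by (simp add: has_real_derivative_iff_has_vector_derivative)
qed

lemma real_solution_deriv2:
  assumes "real_solution q y y' N" "x \<in> {0<..<1} - N"
  shows "(y' has_real_derivative q x * y x) (at x)"
  using assms unfolding real_solution_def by (simp add: has_real_derivative_iff_has_vector_derivative)

lemma real_solution_is_solution_on:
  assumes y: "real_solution q y y' N" and ab: "{a..b} \<subseteq> {0..1}"
  shows "is_solution_on q a b (\<lambda>x. of_real (y x))"
  unfolding is_solution_on_def
proof (intro conjI exI[of _ "\<lambda>x. of_real (y' x)"] ballI)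
  show "abs_cont_on {a..b} (\<lambda>x. complex_of_real (y x))"
       "abs_cont_on {a..b} (\<lambda>x. complex_of_real (y' x))"
    using real_solution_abs_cont[OF y] ab
    by (auto intro!: abs_cont_on_of_real intro: abs_cont_on_subset)
  show "((\<lambda>x. complex_of_real (y x)) has_vector_derivative complex_of_real (y' x)) (at x within {a..b})"
    if "x \<in> {a..b}" for x
  proof -
    have "(y has_vector_derivative y' x) (at x within {0..1})"
      using y ab that unfolding real_solution_def by blast
    then show ?thesis
      using has_vector_derivative_within_subset[OF _ ab] has_vector_derivative_of_real
      by (metis has_real_derivative_iff_has_vector_derivative)
  qed
  show "equation_ae q {a..b} (\<lambda>x. complex_of_real (y x)) (\<lambda>x. complex_of_real (y' x))"
    unfolding equation_ae_def
  proof (rule AE_lebesgueI[of "N \<union> {0,1}"])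
    show "negligible (N \<union> {0,1})" using y by (simp add: real_solution_def)
    fix x assume "x \<notin> N \<union> {0,1}"
    then have "x \<in> {0<..<1} - N" if "x \<in> {a..b}"
      using subsetD[OF ab that] by auto
    then have "((\<lambda>x. complex_of_real (y' x)) has_vector_derivative of_real (q x * y x)) (at x)"
      if "x \<in> {a..b}"
      using real_solution_deriv2[OF y] that by (intro has_vector_derivative_of_real) blast
    then show "x \<in> {a..b} \<longrightarrow> (\<exists>d. ((\<lambda>x. complex_of_real (y' x)) has_vector_derivative d) (at x) \<and>
            - d + complex_of_real (q x) * complex_of_real (y x) = 0)"
      by (intro impI exI[of _ "of_real (q x * y x)"]) simp
  qed
qed

lemma has_vector_derivative_zero_on:
  fixes y :: "real \<Rightarrow> real"
  assumes "(y has_vector_derivative d) (at x within S)" "{a..b} \<subseteq> S" "a < b" "x \<in> {a..b}"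
    "\<And>x. x \<in> {a..b} \<Longrightarrow> y x = 0"
  shows "d = 0"
proof -
  have "(y has_vector_derivative d) (at x within {a..b})"
    using assms(1,2) by (rule has_vector_derivative_within_subset)
  moreover have "(y has_vector_derivative 0) (at x within {a..b})"
    by (rule has_vector_derivative_transform[of _ _ _ "\<lambda>_. 0"]) (use assms in auto)
  ultimately show ?thesis
    using vector_derivative_unique_within_closed_interval[of a b x y] assms(3,4) by auto
qed

text \<open>
  The derivative vanishes as well, including at the end points; this is what contradicts the initial
  values and the Wronskian below.
\<close>

lemma only_zero_imp_trivial:
  assumes oz: "only_zero_dirichlet_solution q a b" and y: "real_solution q y y' N"
    and ab: "0 \<le> a" "a < b" "b \<le> 1" and "y a = 0" "y b = 0" and x: "x \<in> {a..b}"
  shows "y x = 0" "y' x = 0"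
proof -
  have sub: "{a..b} \<subseteq> {0..1}" using ab by auto
  have 0: "y x = 0" if "x \<in> {a..b}" for x
    using oz real_solution_is_solution_on[OF y sub] assms(6,7) that
    unfolding only_zero_dirichlet_solution_def by fastforce
  then show "y x = 0" using x .
  have "(y has_vector_derivative y' x) (at x within {0..1})"
    using y x sub unfolding real_solution_def by blast
  then show "y' x = 0"
    using sub ab(2) x 0 by (rule has_vector_derivative_zero_on)
qed

lemma wronskian_constant:
  assumes u: "real_solution q u u' N" and v: "real_solution q v v' M" and x: "x \<in> {0..1}"
  shows "u' x * v x - u x * v' x = u' 0 * v 0 - u 0 * v' 0"
proof (rule abs_cont_on_const_endpoints[of 0 x _ "N \<union> M"])
  have "abs_cont_on {0..1} (\<lambda>x. u' x * v x - u x * v' x)"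
    using real_solution_abs_cont[OF u] real_solution_abs_cont[OF v]
    by (intro abs_cont_on_diff abs_cont_on_mult) (auto simp: is_interval_cc)
  then show "abs_cont_on {0..x} (\<lambda>x. u' x * v x - u x * v' x)"
    by (rule abs_cont_on_subset) (use x in auto)
  show "negligible (N \<union> M)" using u v by (simp add: real_solution_def)
  fix s assume s: "s \<in> {0<..<x} - (N \<union> M)"
  then have i: "s \<in> {0<..<1}" "s \<in> {0<..<1} - N" "s \<in> {0<..<1} - M" using x by auto
  note d = real_solution_deriv[OF u i(1)] real_solution_deriv[OF v i(1)]
     real_solution_deriv2[OF u i(2)] real_solution_deriv2[OF v i(3)]
  have "((\<lambda>x. u' x * v x - u x * v' x) has_real_derivative 0) (at s)"
    by (rule derivative_eq_intros d refl | simp)+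
  then show "((\<lambda>x. u' x * v x - u x * v' x) has_vector_derivative 0) (at s)"
    by (simp add: has_real_derivative_iff_has_vector_derivative)
qed (use x in auto)

lemma real_solution_diff_mult:
  assumes u: "real_solution q u u' N" and v: "real_solution q v v' M"
  shows "real_solution q (\<lambda>x. u x - c * v x) (\<lambda>x. u' x - c * v' x) (N \<union> M)"
  unfolding real_solution_def
proof (intro conjI ballI)
  show "((\<lambda>x. u x - c * v x) has_vector_derivative u' x - c * v' x) (at x within {0..1})"
    if "x \<in> {0..1}" for x
    using u v that unfolding real_solution_def
    by (intro has_vector_derivative_diff has_vector_derivative_mult_right) auto
  have "abs_cont_on {0..1} (\<lambda>x. c * v' x)"
    by (rule abs_cont_on_mult[OF lipschitz_on_imp_abs_cont_on[OF lipschitz_on_constant] real_solution_abs_cont(2)[OF v]])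
       (auto simp: is_interval_cc)
  then show "abs_cont_on {0..1} (\<lambda>x. u' x - c * v' x)"
    using real_solution_abs_cont(2)[OF u] by (intro abs_cont_on_diff)
  show "negligible (N \<union> M)" using u v by (simp add: real_solution_def)
  show "((\<lambda>x. u' x - c * v' x) has_vector_derivative q x * (u x - c * v x)) (at x)"
    if "x \<in> {0<..<1} - (N \<union> M)" for x
  proof -
    have "((\<lambda>x. u' x - c * v' x) has_vector_derivative q x * u x - c * (q x * v x)) (at x)"
      using u v that unfolding real_solution_def
      by (intro has_vector_derivative_diff has_vector_derivative_mult_right) auto
    then show ?thesis by (simp add: algebra_simps)
  qed
qed

text \<open>
  The spectral datum depends on \<open>q\<close> only through such a pair.  Any two pairs differ by scaling \<open>\<phi>\<close> by a
  constant and \<open>\<psi>\<close> by its inverse, so the product \<open>\<phi> \<psi>\<close> is the same for all of them on \<open>[0,1]\<close>.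
\<close>

locale dirichlet_pair =
  fixes q \<phi> \<phi>' \<psi> \<psi>' :: "real \<Rightarrow> real" and N M :: "real set"
  assumes \<phi>: "real_solution q \<phi> \<phi>' N" and \<psi>: "real_solution q \<psi> \<psi>' M"
    and \<phi>_0: "\<phi> 0 = 0" and \<psi>_1: "\<psi> 1 = 0"
    and wronskian: "\<And>x. x \<in> {0..1} \<Longrightarrow> \<phi>' x * \<psi> x - \<phi> x * \<psi>' x = 1"
    and nonzero: "\<And>x. x \<in> {0<..<1} \<Longrightarrow> \<phi> x \<noteq> 0 \<and> \<psi> x \<noteq> 0"

text \<open>
  The solution \<open>\<psi>\<close> is the combination of the two standard solutions at \<open>0\<close> that vanishes at \<open>1\<close>; it exists
  because \<open>\<phi> 1 \<noteq> 0\<close>, and \<open>\<psi> 0 = 1\<close> makes the Wronskian \<open>1\<close>.  A zero of \<open>\<phi>\<close> or \<open>\<psi>\<close> at an inner point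
  \<open>t\<close> would make that function vanish identically on \<open>[0,t]\<close> or \<open>[t,1]\<close>, which the Wronskian forbids.
\<close>

lemma dirichlet_pair_exists:
  assumes q: "q \<in> potentials"
  obtains \<phi> \<phi>' \<psi> \<psi>' N M where "dirichlet_pair q \<phi> \<phi>' \<psi> \<psi>' N M"
proof -
  have qi: "q absolutely_integrable_on {0..1}" using q by (simp add: potentials_def)
  have oz: "only_zero_dirichlet_solution q 0 1"
      "\<And>t. t \<in> {0<..<1} \<Longrightarrow> only_zero_dirichlet_solution q 0 t"
      "\<And>t. t \<in> {0<..<1} \<Longrightarrow> only_zero_dirichlet_solution q t 1"
    using q dense[of 0 "1::real"] unfolding potentials_def by auto
  obtain \<phi> \<phi>' N where \<phi>0: "\<phi> 0 = 0" "\<phi>' 0 = 1" and \<phi>: "real_solution q \<phi> \<phi>' N"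
    by (rule initial_value_problem[OF qi, of 0 1]) blast
  obtain \<theta> \<theta>' M where \<theta>0: "\<theta> 0 = 1" "\<theta>' 0 = 0" and \<theta>: "real_solution q \<theta> \<theta>' M"
    by (rule initial_value_problem[OF qi, of 1 0]) blast
  have \<phi>1: "\<phi> 1 \<noteq> 0"
    using only_zero_imp_trivial(2)[OF oz(1) \<phi>, of 0] \<phi>0 by auto
  define c where "c = \<theta> 1 / \<phi> 1"
  define \<psi> where "\<psi> = (\<lambda>x. \<theta> x - c * \<phi> x)"
  define \<psi>' where "\<psi>' = (\<lambda>x. \<theta>' x - c * \<phi>' x)"
  have \<psi>: "real_solution q \<psi> \<psi>' (M \<union> N)"
    unfolding \<psi>_def \<psi>'_def by (rule real_solution_diff_mult[OF \<theta> \<phi>])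
  have \<psi>1: "\<psi> 1 = 0" using \<phi>1 by (simp add: \<psi>_def c_def)
  have W: "\<phi>' x * \<psi> x - \<phi> x * \<psi>' x = 1" if "x \<in> {0..1}" for x
    using wronskian_constant[OF \<phi> \<psi> that] \<phi>0 \<theta>0 by (simp add: \<psi>_def)
  have "\<phi> t \<noteq> 0" if "t \<in> {0<..<1}" for t
    using only_zero_imp_trivial(2)[OF oz(2)[OF that] \<phi>, of 0] \<phi>0 that by auto
  moreover have "\<psi> t \<noteq> 0" if "t \<in> {0<..<1}" for t
    using only_zero_imp_trivial[OF oz(3)[OF that] \<psi>, of t] \<psi>1 that W[of t] by auto
  ultimately have "dirichlet_pair q \<phi> \<phi>' \<psi> \<psi>' N (M \<union> N)"
    by unfold_locales (use \<phi> \<psi> \<phi>0 \<psi>1 W in auto)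
  then show thesis by (rule that)
qed

section \<open>The eigenvalue of the problem with a delta interaction\<close>

text \<open>
  The Wronskian of \<open>y\<close> and \<open>u\<close> is constant on the open interval.  At the end point \<open>e\<close> both functions
  tend to zero while their derivatives stay bounded, so the constant is zero.  Boundedness of
  \<open>dy\<close> follows from its absolute continuity on the open interval, without any value at \<open>e\<close>.
\<close>

lemma complex_wronskian_zero:
  fixes y dy :: "real \<Rightarrow> complex"
  assumes u: "real_solution q u u' N" and ab: "0 \<le> a" "a < b" "b \<le> 1"
    and yac: "abs_cont_on {a..b} y"
    and der: "\<And>x. x \<in> {a<..<b} \<Longrightarrow> (y has_vector_derivative dy x) (at x)"
    and dac: "abs_cont_on {a<..<b} dy"
    and K: "negligible K" "\<And>x. x \<in> {a<..<b} - K \<Longrightarrow> (dy has_vector_derivative of_real (q x) * y x) (at x)"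
    and e: "e \<in> {a, b}" "y e = 0" "u e = 0" and x: "x \<in> {a<..<b}"
  shows "dy x * of_real (u x) = y x * of_real (u' x)"
proof -
  let ?S = "{a<..<b}"
  define W where "W = (\<lambda>x. dy x * of_real (u x) - y x * of_real (u' x))"
  have S: "is_interval ?S" "bounded ?S" "?S \<subseteq> {a..b}" "?S \<subseteq> {0..1}" "{a..b} \<subseteq> {0..1}"
    using ab by (auto simp: is_interval_oo)
  have Wac: "abs_cont_on ?S W"
    unfolding W_def
    using abs_cont_on_subset[OF yac S(3)] dac real_solution_abs_cont[OF u] S
    by (intro abs_cont_on_diff abs_cont_on_mult abs_cont_on_of_real) (auto intro: abs_cont_on_subset)
  have const: "W d = W c" if cd: "c \<in> ?S" "d \<in> ?S" "c \<le> d" for c d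
  proof (rule abs_cont_on_const_endpoints[of c d W "N \<union> K"])
    show "abs_cont_on {c..d} W" by (rule abs_cont_on_subset[OF Wac]) (use cd in auto)
    show "negligible (N \<union> K)" using u K by (simp add: real_solution_def)
    fix s assume s: "s \<in> {c<..<d} - (N \<union> K)"
    then have i: "s \<in> ?S" "s \<in> ?S - K" "s \<in> {0<..<1}" "s \<in> {0<..<1} - N" using cd ab by auto
    have "(W has_vector_derivative
        (dy s * of_real (u' s) + (of_real (q s) * y s) * of_real (u s)) -
        (y s * of_real (q s * u s) + dy s * of_real (u' s))) (at s)"
      unfolding W_def
      by (intro has_vector_derivative_diff has_vector_derivative_mult has_vector_derivative_of_real
          der K i real_solution_deriv[OF u] real_solution_deriv2[OF u])
    then show "(W has_vector_derivative 0) (at s)" by (simp add: algebra_simps)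
  qed (use cd in auto)
  let ?F = "at e within ?S"
  have "e islimpt ?S"
    using e(1) ab islimpt_greaterThanLessThan1[of a b] islimpt_greaterThanLessThan2[of a b] by auto
  then have F: "?F \<noteq> bot" by (simp add: trivial_limit_within)
  have lim_y: "(y \<longlongrightarrow> 0) ?F"
  proof -
    have "continuous_on {a..b} y"
      using abs_cont_on_imp_uniformly_continuous_on[OF yac] uniformly_continuous_imp_continuous
      by (auto simp: is_interval_cc)
    then have "(y \<longlongrightarrow> y e) (at e within {a..b})"
      using e(1) ab unfolding continuous_on_def by auto
    then show ?thesis using tendsto_within_subset[OF _ S(3)] e(2) by auto
  qed
  have lim_u: "(u \<longlongrightarrow> 0) ?F"
  proof -
    have "(u \<longlongrightarrow> u e) (at e within {0..1})"
      using e(1) ab real_solution_continuous(1)[OF u] unfolding continuous_on_def by auto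
    then show ?thesis using tendsto_within_subset[OF _ S(4)] e(3) by auto
  qed
  obtain B where B: "\<And>s. s \<in> ?S \<Longrightarrow> norm (dy s) \<le> B"
    using abs_cont_on_imp_bounded[OF dac S(1,2)] unfolding bounded_iff by blast
  have "bounded (u' ` {0..1})"
    by (rule abs_cont_on_imp_bounded[OF real_solution_abs_cont(2)[OF u]]) (auto simp: is_interval_cc)
  then obtain C where C: "\<And>s. s \<in> {0..1} \<Longrightarrow> norm (u' s) \<le> C"
    unfolding bounded_iff by blast
  have "(W \<longlongrightarrow> 0) ?F"
  proof (rule Lim_null_comparison)
    have "norm (W s) \<le> B * \<bar>u s\<bar> + C * norm (y s)" if "s \<in> ?S" for s
    proof -
      have "norm (W s) \<le> norm (dy s) * \<bar>u s\<bar> + norm (u' s) * norm (y s)"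
        unfolding W_def by (rule order_trans[OF norm_triangle_ineq4]) (simp add: norm_mult)
      also have "\<dots> \<le> B * \<bar>u s\<bar> + C * norm (y s)"
        using B[OF that] C[of s] that S(4) by (intro add_mono mult_right_mono) auto
      finally show ?thesis .
    qed
    then show "\<forall>\<^sub>F s in ?F. norm (W s) \<le> B * \<bar>u s\<bar> + C * norm (y s)"
      by (auto simp: eventually_at intro: exI[of _ 1])
    show "((\<lambda>s. B * \<bar>u s\<bar> + C * norm (y s)) \<longlongrightarrow> 0) ?F"
      using tendsto_add[OF tendsto_mult[OF tendsto_const tendsto_rabs[OF lim_u], of B]
          tendsto_mult[OF tendsto_const tendsto_norm[OF lim_y], of C]] by simp
  qed
  moreover have "(W \<longlongrightarrow> W x) ?F"
  proof (rule tendsto_eventually)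
    have "W s = W x" if "s \<in> ?S" for s
      using const[of s x] const[of x s] x that by (cases "s \<le> x") auto
    then show "\<forall>\<^sub>F s in ?F. W s = W x" by (auto simp: eventually_at intro: exI[of _ 1])
  qed
  ultimately have "W x = 0" using tendsto_unique[OF F] by blast
  then show ?thesis by (simp add: W_def)
qed

text \<open>
  The equation between the derivatives says that \<open>y / u\<close> has derivative zero.
\<close>

lemma quotient_constant:
  fixes y dy :: "real \<Rightarrow> complex"
  assumes u: "real_solution q u u' N" and cd: "0 \<le> c" "c \<le> d" "d \<le> 1"
    and yc: "continuous_on {c..d} y"
    and der: "\<And>x. x \<in> {c<..<d} \<Longrightarrow> (y has_vector_derivative dy x) (at x)"
    and eq: "\<And>x. x \<in> {c<..<d} \<Longrightarrow> dy x * of_real (u x) = y x * of_real (u' x)"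
    and nz: "\<And>x. x \<in> {c..d} \<Longrightarrow> u x \<noteq> 0"
  shows "y d * of_real (inverse (u d)) = y c * of_real (inverse (u c))"
proof -
  let ?k = "\<lambda>x. y x * of_real (inverse (u x))"
  have "((\<lambda>_. 0) has_integral ?k d - ?k c) {c..d}"
  proof (rule fundamental_theorem_of_calculus_interior[OF cd(2)])
    have "{c..d} \<subseteq> {0..1}" using cd by auto
    then have "continuous_on {c..d} u"
      using real_solution_continuous(1)[OF u] continuous_on_subset by blast
    then show "continuous_on {c..d} ?k"
      using nz by (intro continuous_intros yc) auto
    fix x assume x: "x \<in> {c<..<d}"
    then have "x \<in> {0<..<1}" "u x \<noteq> 0" using cd nz[of x] by auto
    then have "((\<lambda>x. inverse (u x)) has_real_derivative - (inverse (u x) * u' x * inverse (u x))) (at x)"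
      by (intro DERIV_inverse' real_solution_deriv[OF u])
    then have "(?k has_vector_derivative y x * of_real (- (inverse (u x) * u' x * inverse (u x)))
        + dy x * of_real (inverse (u x))) (at x)"
      by (intro has_vector_derivative_mult has_vector_derivative_of_real der x)
    also have "y x * of_real (- (inverse (u x) * u' x * inverse (u x))) + dy x * of_real (inverse (u x))
        = (dy x * of_real (u x) - y x * of_real (u' x)) * of_real (inverse (u x) * inverse (u x))"
      using \<open>u x \<noteq> 0\<close> by (simp add: field_simps)
    also have "\<dots> = 0" by (simp only: eq[OF x] diff_self mult_zero_left)
    finally show "(?k has_vector_derivative 0) (at x)" .
  qed
  then have "?k d - ?k c = 0" using has_integral_0 has_integral_unique by blast
  then show ?thesis by simp
qed

context dirichlet_pair
begin

text \<open>
  On the two sides of \<open>t\<close> the Wronskians with \<open>\<phi>\<close> and \<open>\<psi>\<close> vanish, so \<open>y'\<close> tends to \<open>y t\<close> times \<open>\<phi>'/\<phi>\<close> from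
  the left and to \<open>y t\<close> times \<open>\<psi>'/\<psi>\<close> from the right.  If \<open>y t\<close> were zero, the proportionality of \<open>y\<close> to
  \<open>\<phi>\<close> and \<open>\<psi>\<close> would force \<open>y\<close> to vanish everywhere; hence it can be cancelled in the jump condition.
\<close>

lemma eigenvalue_unique:
  assumes t: "t \<in> {0<..<1}" and sol: "is_delta_solution q t \<mu> y" and nt: "\<exists>x\<in>{0..1}. y x \<noteq> 0"
  shows "\<mu> = of_real (1 / (\<phi> t * \<psi> t))"
proof -
  obtain dy dl dr where yac: "abs_cont_on {0..1} y" and y01: "y 0 = 0" "y 1 = 0"
    and der: "\<And>x. x \<in> {0<..<t} \<union> {t<..<1} \<Longrightarrow> (y has_vector_derivative dy x) (at x)"
    and dac: "abs_cont_on {0<..<t} dy" "abs_cont_on {t<..<1} dy"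
    and ae: "equation_ae q ({0..1} - {t}) y dy"
    and dl: "(dy \<longlongrightarrow> dl) (at_left t)" and dr: "(dy \<longlongrightarrow> dr) (at_right t)"
    and jump: "dl - dr = \<mu> * y t"
    using sol unfolding is_delta_solution_def by blast
  obtain K where K: "negligible K" and K': "\<And>x. x \<notin> K \<Longrightarrow> x \<in> {0..1} - {t} \<longrightarrow>
      (\<exists>d. (dy has_vector_derivative d) (at x) \<and> - d + complex_of_real (q x) * y x = 0)"
    using ae unfolding equation_ae_def by (rule AE_lebesgueE) blast
  have ode: "(dy has_vector_derivative of_real (q x) * y x) (at x)" if "x \<in> {0..1} - {t}" "x \<notin> K" for x
    using K'[OF that(2)] that(1) by (auto simp: add_eq_0_iff)
  have yc: "continuous_on {0..1} y"
    using abs_cont_on_imp_uniformly_continuous_on[OF yac] uniformly_continuous_imp_continuous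
    by (auto simp: is_interval_cc)
  have L: "dy x * of_real (\<phi> x) = y x * of_real (\<phi>' x)" if "x \<in> {0<..<t}" for x
    by (rule complex_wronskian_zero[OF \<phi>, of 0 t y dy K 0])
       (use t y01 \<phi>_0 dac der ode K that in \<open>auto intro: abs_cont_on_subset[OF yac]\<close>)
  have R: "dy x * of_real (\<psi> x) = y x * of_real (\<psi>' x)" if "x \<in> {t<..<1}" for x
    by (rule complex_wronskian_zero[OF \<psi>, of t 1 y dy K 1])
       (use t y01 \<psi>_1 dac der ode K that in \<open>auto intro: abs_cont_on_subset[OF yac]\<close>)
  have yt: "y t \<noteq> 0"
  proof
    assume yt: "y t = 0"
    have left: "y x = 0" if "x \<in> {0<..<t}" for x
    proof -
      have "y t * of_real (inverse (\<phi> t)) = y x * of_real (inverse (\<phi> x))"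
        by (rule quotient_constant[OF \<phi>, of x t y dy])
           (use that t L der nonzero in \<open>auto intro: continuous_on_subset[OF yc]\<close>)
      then show ?thesis using yt nonzero[of x] that t by simp
    qed
    have right: "y x = 0" if "x \<in> {t<..<1}" for x
    proof -
      have "y x * of_real (inverse (\<psi> x)) = y t * of_real (inverse (\<psi> t))"
        by (rule quotient_constant[OF \<psi>, of t x y dy])
           (use that t R der nonzero in \<open>auto intro: continuous_on_subset[OF yc]\<close>)
      then show ?thesis using yt nonzero[of x] that t by simp
    qed
    have "y x = 0" if "x \<in> {0..1}" for x
    proof -
      have "x = 0 \<or> (0 < x \<and> x < t) \<or> x = t \<or> (t < x \<and> x < 1) \<or> x = 1"
        using that t by (auto simp: order_le_less)
      then show ?thesis using left[of x] right[of x] yt y01 by auto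
    qed
    then show False using nt by blast
  qed
  have cont_t: "isCont y t" "isCont \<phi> t" "isCont \<phi>' t" "isCont \<psi> t" "isCont \<psi>' t"
    using yc real_solution_continuous[OF \<phi>] real_solution_continuous[OF \<psi>] t
    by (auto intro!: continuous_on_interior)
  note lim = cont_t[unfolded isCont_def]
  have "((\<lambda>x. y x * of_real (\<phi>' x) / of_real (\<phi> x)) \<longlongrightarrow> y t * of_real (\<phi>' t) / of_real (\<phi> t)) (at_left t)"
    using nonzero[OF t] by (intro tendsto_intros tendsto_mono[OF at_le lim(1)] tendsto_mono[OF at_le lim(2)]
        tendsto_mono[OF at_le lim(3)]) auto
  moreover have "\<forall>\<^sub>F x in at_left t. y x * of_real (\<phi>' x) / of_real (\<phi> x) = dy x"
  proof (rule eventually_mono)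
    show "\<forall>\<^sub>F x in at_left t. x \<in> {0<..<t}" using eventually_at_left_real[of 0 t] t by simp
    show "y x * of_real (\<phi>' x) / of_real (\<phi> x) = dy x" if "x \<in> {0<..<t}" for x
      using L[OF that] nonzero[of x] that t by (simp add: field_simps)
  qed
  ultimately have "(dy \<longlongrightarrow> y t * of_real (\<phi>' t) / of_real (\<phi> t)) (at_left t)"
    by (rule Lim_transform_eventually)
  then have dl_eq: "dl = y t * of_real (\<phi>' t) / of_real (\<phi> t)"
    using tendsto_unique[OF _ dl] by (simp add: trivial_limit_at_left_real)
  have "((\<lambda>x. y x * of_real (\<psi>' x) / of_real (\<psi> x)) \<longlongrightarrow> y t * of_real (\<psi>' t) / of_real (\<psi> t)) (at_right t)"
    using nonzero[OF t] by (intro tendsto_intros tendsto_mono[OF at_le lim(1)] tendsto_mono[OF at_le lim(4)]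
        tendsto_mono[OF at_le lim(5)]) auto
  moreover have "\<forall>\<^sub>F x in at_right t. y x * of_real (\<psi>' x) / of_real (\<psi> x) = dy x"
  proof (rule eventually_mono)
    show "\<forall>\<^sub>F x in at_right t. x \<in> {t<..<1}" using eventually_at_right_real[of t 1] t by simp
    show "y x * of_real (\<psi>' x) / of_real (\<psi> x) = dy x" if "x \<in> {t<..<1}" for x
      using R[OF that] nonzero[of x] that t by (simp add: field_simps)
  qed
  ultimately have "(dy \<longlongrightarrow> y t * of_real (\<psi>' t) / of_real (\<psi> t)) (at_right t)"
    by (rule Lim_transform_eventually)
  then have dr_eq: "dr = y t * of_real (\<psi>' t) / of_real (\<psi> t)"
    using tendsto_unique[OF _ dr] by (simp add: trivial_limit_at_right_real)
  have "\<mu> * y t = y t * of_real ((\<phi>' t * \<psi> t - \<phi> t * \<psi>' t) / (\<phi> t * \<psi> t))"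
    using nonzero[OF t] unfolding jump[symmetric] dl_eq dr_eq by (simp add: field_simps)
  also have "(\<phi>' t * \<psi> t - \<phi> t * \<psi>' t) / (\<phi> t * \<psi> t) = 1 / (\<phi> t * \<psi> t)"
    using wronskian[of t] t by simp
  finally show ?thesis using yt by (simp only: mult.commute[of "y t"] mult_right_cancel[OF yt])
qed

lemma green_function_is_eigenfunction:
  assumes t: "t \<in> {0<..<1}"
  shows "is_eigenvalue q t (of_real (1 / (\<phi> t * \<psi> t)))"
proof -
  define y where "y = (\<lambda>x. complex_of_real (\<phi> (min x t) * \<psi> (max x t)))"
  define dy where "dy = (\<lambda>x. complex_of_real (if x < t then \<phi>' x * \<psi> t else \<phi> t * \<psi>' x))"
  have ac_comp: "abs_cont_on {0..1} (\<lambda>x. u (c x))"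
    if sol: "real_solution q u u' P" and c: "\<And>x. x \<in> {0..1} \<Longrightarrow> c x \<in> {0..1}" "\<And>x z. \<bar>c x - c z\<bar> \<le> \<bar>x - z\<bar>"
    for u u' P and c :: "real \<Rightarrow> real"
  proof -
    obtain L where L: "L-lipschitz_on {0..1} u" by (rule real_solution_lipschitz[OF sol])
    have "1-lipschitz_on {0..1} c" by (rule lipschitz_onI) (simp_all add: dist_real_def c(2))
    then have "abs_cont_on {0..1} c" by (rule lipschitz_on_imp_abs_cont_on)
    then show ?thesis
      by (rule abs_cont_on_compose_lipschitz) (rule lipschitz_on_subset[OF L], use c(1) in blast)
  qed
  have yac: "abs_cont_on {0..1} y"
    unfolding y_def
    by (intro abs_cont_on_of_real abs_cont_on_mult ac_comp[OF \<phi>] ac_comp[OF \<psi>])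
       (use t in \<open>auto simp: is_interval_cc min_def max_def\<close>)
  have derL: "(y has_vector_derivative dy x) (at x)" if x: "x \<in> {0<..<t}" for x
  proof (rule has_vector_derivative_transform_within_open)
    have "((\<lambda>x. \<phi> x * \<psi> t) has_real_derivative \<phi>' x * \<psi> t) (at x)"
      using x t by (intro DERIV_cmult_right real_solution_deriv[OF \<phi>]) auto
    from has_vector_derivative_of_real[OF this]
    show "((\<lambda>x. complex_of_real (\<phi> x * \<psi> t)) has_vector_derivative dy x) (at x)"
      using x by (simp add: dy_def)
  qed (use x in \<open>auto simp: y_def min_def max_def intro: open_greaterThanLessThan\<close>)
  have derR: "(y has_vector_derivative dy x) (at x)" if x: "x \<in> {t<..<1}" for x
  proof (rule has_vector_derivative_transform_within_open)
    have "((\<lambda>x. \<phi> t * \<psi> x) has_real_derivative \<phi> t * \<psi>' x) (at x)"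
      using x t by (intro DERIV_cmult real_solution_deriv[OF \<psi>]) auto
    from has_vector_derivative_of_real[OF this]
    show "((\<lambda>x. complex_of_real (\<phi> t * \<psi> x)) has_vector_derivative dy x) (at x)"
      using x by (simp add: dy_def)
  qed (use x in \<open>auto simp: y_def min_def max_def intro: open_greaterThanLessThan\<close>)
  have const: "abs_cont_on S (\<lambda>_. c)" for S and c :: real
    by (rule lipschitz_on_imp_abs_cont_on[OF lipschitz_on_constant])
  have acL: "abs_cont_on {0..1} (\<lambda>x. complex_of_real (\<phi>' x * \<psi> t))"
    by (intro abs_cont_on_of_real abs_cont_on_mult real_solution_abs_cont(2)[OF \<phi>] const)
       (auto simp: is_interval_cc)
  have acR: "abs_cont_on {0..1} (\<lambda>x. complex_of_real (\<phi> t * \<psi>' x))"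
    by (intro abs_cont_on_of_real abs_cont_on_mult real_solution_abs_cont(2)[OF \<psi>] const)
       (auto simp: is_interval_cc)
  have dacL: "abs_cont_on {0<..<t} dy"
    by (rule abs_cont_on_cong[OF abs_cont_on_subset[OF acL]]) (use t in \<open>auto simp: dy_def\<close>)
  have dacR: "abs_cont_on {t<..<1} dy"
    by (rule abs_cont_on_cong[OF abs_cont_on_subset[OF acR]]) (use t in \<open>auto simp: dy_def\<close>)
  have ae: "equation_ae q ({0..1} - {t}) y dy"
    unfolding equation_ae_def
  proof (rule AE_lebesgueI[of "N \<union> M \<union> {0,1}"])
    show "negligible (N \<union> M \<union> {0,1})" using \<phi> \<psi> by (simp add: real_solution_def)
    fix x assume x: "x \<notin> N \<union> M \<union> {0,1}"
    have "(dy has_vector_derivative of_real (q x) * y x) (at x)" if "x \<in> {0..1} - {t}"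
    proof (cases "x < t")
      case True
      show ?thesis
      proof (rule has_vector_derivative_transform_within_open[of _ _ _ "{0<..<t}"])
        have "((\<lambda>x. \<phi>' x * \<psi> t) has_real_derivative q x * \<phi> x * \<psi> t) (at x)"
          using x that t True by (intro DERIV_cmult_right real_solution_deriv2[OF \<phi>]) auto
        from has_vector_derivative_of_real[OF this]
        show "((\<lambda>x. complex_of_real (\<phi>' x * \<psi> t)) has_vector_derivative of_real (q x) * y x) (at x)"
          using True by (simp add: y_def mult.assoc)
      qed (use x that t True in \<open>auto simp: dy_def\<close>)
    next
      case False
      show ?thesis
      proof (rule has_vector_derivative_transform_within_open[of _ _ _ "{t<..<1}"])
        have "((\<lambda>x. \<phi> t * \<psi>' x) has_real_derivative \<phi> t * (q x * \<psi> x)) (at x)"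
          using x that t False by (intro DERIV_cmult real_solution_deriv2[OF \<psi>]) auto
        from has_vector_derivative_of_real[OF this]
        show "((\<lambda>x. complex_of_real (\<phi> t * \<psi>' x)) has_vector_derivative of_real (q x) * y x) (at x)"
          using False that by (simp add: y_def mult_ac)
      qed (use x that t False in \<open>auto simp: dy_def\<close>)
    qed
    then show "x \<in> {0..1} - {t} \<longrightarrow> (\<exists>d. (dy has_vector_derivative d) (at x) \<and>
        - d + complex_of_real (q x) * y x = 0)"
      by (intro impI exI[of _ "of_real (q x) * y x"]) simp
  qed
  have cont_t: "isCont \<phi>' t" "isCont \<psi>' t"
    using real_solution_continuous[OF \<phi>] real_solution_continuous[OF \<psi>] t
    by (auto intro!: continuous_on_interior)
  note lim = cont_t[unfolded isCont_def]
  have "((\<lambda>x. complex_of_real (\<phi>' x * \<psi> t)) \<longlongrightarrow> of_real (\<phi>' t * \<psi> t)) (at_left t)"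
    by (intro tendsto_intros tendsto_mono[OF at_le lim(1)]) auto
  moreover have "\<forall>\<^sub>F x in at_left t. complex_of_real (\<phi>' x * \<psi> t) = dy x"
    by (auto simp: eventually_at_filter dy_def)
  ultimately have dl: "(dy \<longlongrightarrow> of_real (\<phi>' t * \<psi> t)) (at_left t)"
    by (rule Lim_transform_eventually)
  have "((\<lambda>x. complex_of_real (\<phi> t * \<psi>' x)) \<longlongrightarrow> of_real (\<phi> t * \<psi>' t)) (at_right t)"
    by (intro tendsto_intros tendsto_mono[OF at_le lim(2)]) auto
  moreover have "\<forall>\<^sub>F x in at_right t. complex_of_real (\<phi> t * \<psi>' x) = dy x"
    by (auto simp: eventually_at_filter dy_def)
  ultimately have dr: "(dy \<longlongrightarrow> of_real (\<phi> t * \<psi>' t)) (at_right t)"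
    by (rule Lim_transform_eventually)
  have yt: "y t = of_real (\<phi> t * \<psi> t)" by (simp add: y_def)
  have nz: "y t \<noteq> 0" using nonzero[OF t] by (simp add: yt)
  have "of_real (\<phi>' t * \<psi> t) - of_real (\<phi> t * \<psi>' t) = (1 :: complex)"
    using wronskian[of t] t by (metis atLeastAtMost_iff greaterThanLessThan_iff less_imp_le of_real_1 of_real_diff)
  then have jump: "of_real (\<phi>' t * \<psi> t) - of_real (\<phi> t * \<psi>' t) = of_real (1 / (\<phi> t * \<psi> t)) * y t"
    using nonzero[OF t] by (simp add: yt)
  have y01: "y 0 = 0" "y 1 = 0" using t \<phi>_0 \<psi>_1 by (simp_all add: y_def min_def max_def)
  have "is_delta_solution q t (of_real (1 / (\<phi> t * \<psi> t))) y"
    unfolding is_delta_solution_def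
    using yac derL derR dacL dacR ae dl dr jump y01 by blast
  then show ?thesis
    unfolding is_eigenvalue_def using nz t by (meson atLeastAtMost_iff greaterThanLessThan_iff less_imp_le)
qed

end

section \<open>Recovering the potential\<close>

text \<open>
  Here \<open>P, p\<close> and \<open>S, s\<close> are the values and derivatives of the two solutions at a point, and \<open>g, g1, g2\<close>
  are those of their product.  The left-hand side is the reconstruction formula for \<open>1/g\<close>, with
  \<open>(1/g)'\<close> and \<open>(1/g)''\<close> expressed by \<open>g\<close>, and simplifies to \<open>(2 g g2 - g1\<^sup>2 + 1) / (4 g\<^sup>2)\<close>.
\<close>

lemma reciprocal_product_identity:
  fixes P p S s q g g1 g2 :: real
  assumes W: "p * S - P * s = 1" and g: "g = P * S" "g \<noteq> 0"
    and g1: "g1 = p * S + P * s" and g2: "g2 = 2 * q * g + 2 * p * s"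
  shows "- (1/2) * ((2 * g1\<^sup>2 / g ^ 3 - g2 / g\<^sup>2) / (1 / g)) + 3/4 * ((- g1 / g\<^sup>2) / (1 / g))\<^sup>2
          + 1/4 * (1 / g)\<^sup>2 = q"
proof -
  have "g1\<^sup>2 = (p * S - P * s)\<^sup>2 + 4 * g * (p * s)"
    by (simp add: g g1 power2_eq_square algebra_simps)
  then have sq: "g1\<^sup>2 = 1 + 4 * g * (p * s)" by (simp add: W)
  have "- (1/2) * ((2 * g1\<^sup>2 / g ^ 3 - g2 / g\<^sup>2) / (1 / g)) + 3/4 * ((- g1 / g\<^sup>2) / (1 / g))\<^sup>2
          + 1/4 * (1 / g)\<^sup>2 = (2 * g * g2 - g1\<^sup>2 + 1) / (4 * g\<^sup>2)"
    using g(2) by (simp add: field_simps power2_eq_square power3_eq_cube)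
  also have "2 * g * g2 - g1\<^sup>2 + 1 = q * (4 * g\<^sup>2)"
    unfolding sq g2 by (simp add: power2_eq_square algebra_simps)
  finally show ?thesis using g(2) by simp
qed

lemma DERIV_inverse_square:
  fixes f :: "real \<Rightarrow> real"
  assumes "(f has_real_derivative f1) (at t)" "f t \<noteq> 0"
  shows "((\<lambda>t. 1 / (f t)\<^sup>2) has_real_derivative - 2 * f1 / (f t) ^ 3) (at t)"
  using assms
  by (auto intro!: derivative_eq_intros simp: field_simps power2_eq_square power3_eq_cube)

lemma DERIV_minus_divide_square:
  fixes f h :: "real \<Rightarrow> real"
  assumes f: "(f has_real_derivative f1) (at t)" and h: "(h has_real_derivative h1) (at t)" and nz: "f t \<noteq> 0"
  shows "((\<lambda>t. - h t / (f t)\<^sup>2) has_real_derivative 2 * (h t * f1) / (f t) ^ 3 - h1 / (f t)\<^sup>2) (at t)"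
proof -
  have "((\<lambda>t. - h t * (1 / (f t)\<^sup>2)) has_real_derivative
      (- h1) * (1 / (f t)\<^sup>2) + (- 2 * f1 / (f t) ^ 3) * (- h t)) (at t)"
    by (rule DERIV_mult[OF DERIV_minus[OF h] DERIV_inverse_square[OF f nz]])
  then show ?thesis by (simp add: algebra_simps)
qed

lemma deriv_eq_on_open:
  assumes "open S" "x \<in> S" "\<And>y. y \<in> S \<Longrightarrow> f y = g y"
  shows "deriv f x = deriv g x"
  by (rule deriv_cong_ev) (use assms in \<open>auto simp: eventually_nhds\<close>)

lemma reconstruct_cong:
  assumes "\<And>t. t \<in> {0<..<1} \<Longrightarrow> \<Lambda> t = \<Gamma> t" and x: "x \<in> {0<..<1}"
  shows "reconstruct \<Lambda> x = reconstruct \<Gamma> x"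
proof -
  have 1: "deriv \<Lambda> y = deriv \<Gamma> y" if "y \<in> {0<..<1}" for y
    by (rule deriv_eq_on_open[OF open_greaterThanLessThan that assms(1)])
  then have "deriv (deriv \<Lambda>) x = deriv (deriv \<Gamma>) x"
    by (rule deriv_eq_on_open[OF open_greaterThanLessThan x])
  then show ?thesis unfolding reconstruct_def using 1[OF x] assms(1)[OF x] by simp
qed

context dirichlet_pair
begin

lemma eigenvalues:
  assumes "t \<in> {0<..<1}"
  shows "{\<mu>. is_eigenvalue q t \<mu>} = {of_real (1 / (\<phi> t * \<psi> t))}"
  using eigenvalue_unique[OF assms] green_function_is_eigenfunction[OF assms]
  unfolding is_eigenvalue_def by blast

lemma spectral_datum_eq:
  assumes "t \<in> {0<..<1}"
  shows "spectral_datum q t = 1 / (\<phi> t * \<psi> t)"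
  unfolding spectral_datum_def eigenvalues[OF assms] by (rule the_equality) (rule refl, drule singleton_inject, simp only: of_real_eq_iff)

lemma spectral_datum_has_derivative:
  assumes t: "t \<in> {0<..<1}"
  shows "(spectral_datum q has_real_derivative
      - (\<phi>' t * \<psi> t + \<phi> t * \<psi>' t) / (\<phi> t * \<psi> t)\<^sup>2) (at t)"
proof (rule has_field_derivative_transform_within_open[of _ _ _ "{0<..<1}"])
  note d = real_solution_deriv[OF \<phi> t] real_solution_deriv[OF \<psi> t]
  show "((\<lambda>t. 1 / (\<phi> t * \<psi> t)) has_real_derivative
      - (\<phi>' t * \<psi> t + \<phi> t * \<psi>' t) / (\<phi> t * \<psi> t)\<^sup>2) (at t)"
    by (rule derivative_eq_intros d refl | use nonzero[OF t] in \<open>simp add: power2_eq_square\<close>)+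
qed (use t spectral_datum_eq in auto)

lemmas deriv_spectral_datum = DERIV_imp_deriv[OF spectral_datum_has_derivative]

lemma deriv_spectral_datum_has_derivative:
  assumes t: "t \<in> {0<..<1} - (N \<union> M)"
  defines "g \<equiv> \<phi> t * \<psi> t" and "g1 \<equiv> \<phi>' t * \<psi> t + \<phi> t * \<psi>' t"
  shows "(deriv (spectral_datum q) has_real_derivative
      2 * g1\<^sup>2 / g ^ 3 - (2 * q t * g + 2 * \<phi>' t * \<psi>' t) / g\<^sup>2) (at t)"
proof (rule has_field_derivative_transform_within_open[of _ _ _ "{0<..<1}"])
  have t': "t \<in> {0<..<1}" "t \<in> {0<..<1} - N" "t \<in> {0<..<1} - M" using t by auto
  note d = real_solution_deriv[OF \<phi> t'(1)] real_solution_deriv[OF \<psi> t'(1)]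
     real_solution_deriv2[OF \<phi> t'(2)] real_solution_deriv2[OF \<psi> t'(3)]
  have nz: "\<phi> t * \<psi> t \<noteq> 0" using nonzero[OF t'(1)] by simp
  have d1: "((\<lambda>t. \<phi> t * \<psi> t) has_real_derivative g1) (at t)"
    unfolding g1_def by (rule derivative_eq_intros d refl | simp)+
  have d2: "((\<lambda>t. \<phi>' t * \<psi> t + \<phi> t * \<psi>' t) has_real_derivative (2 * q t * g + 2 * \<phi>' t * \<psi>' t)) (at t)"
    unfolding g_def by (rule derivative_eq_intros d refl | simp)+
  show "((\<lambda>t. - (\<phi>' t * \<psi> t + \<phi> t * \<psi>' t) / (\<phi> t * \<psi> t)\<^sup>2) has_real_derivative
      2 * g1\<^sup>2 / g ^ 3 - (2 * q t * g + 2 * \<phi>' t * \<psi>' t) / g\<^sup>2) (at t)"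
    using DERIV_minus_divide_square[OF d1 d2 nz] by (simp only: g_def g1_def power2_eq_square)
qed (use t deriv_spectral_datum in auto)

lemma reconstruct_spectral_datum:
  assumes t: "t \<in> {0<..<1} - (N \<union> M)"
  shows "q t = reconstruct (spectral_datum q) t"
proof -
  have t': "t \<in> {0<..<1}" "t \<in> {0..1}" using t by auto
  have "reconstruct (spectral_datum q) t = q t"
    unfolding reconstruct_def spectral_datum_eq[OF t'(1)] deriv_spectral_datum[OF t'(1)]
      DERIV_imp_deriv[OF deriv_spectral_datum_has_derivative[OF t]]
    by (rule reciprocal_product_identity[OF wronskian[OF t'(2)]]) (use nonzero[OF t'(1)] in auto)
  then show ?thesis by simp
qed

text \<open>
  By the Wronskian, \<open>\<phi>' \<psi> + \<phi> \<psi>' = 2 \<phi>' \<psi> - 1\<close>, so the derivative of the spectral datum is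
  \<open>r - 2 \<phi>' \<psi> r\<close> with \<open>r = 1/(\<phi> \<psi>)\<^sup>2\<close>.  On \<open>[a,b]\<close> the factor \<open>r\<close> is continuously differentiable, and the
  others are absolutely continuous.
\<close>

lemma abs_cont_on_deriv_spectral_datum:
  assumes ab: "0 < a" "a < b" "b < 1"
  shows "abs_cont_on {a..b} (deriv (spectral_datum q))"
proof -
  let ?r = "\<lambda>t. 1 / (\<phi> t * \<psi> t)\<^sup>2"
  have sub: "{a..b} \<subseteq> {0..1}" using ab by auto
  note cont = continuous_on_subset[OF real_solution_continuous(1)[OF \<phi>] sub]
    continuous_on_subset[OF real_solution_continuous(2)[OF \<phi>] sub]
    continuous_on_subset[OF real_solution_continuous(1)[OF \<psi>] sub]
    continuous_on_subset[OF real_solution_continuous(2)[OF \<psi>] sub]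
  note ac = abs_cont_on_subset[OF real_solution_abs_cont(1)[OF \<phi>] sub]
    abs_cont_on_subset[OF real_solution_abs_cont(2)[OF \<phi>] sub]
    abs_cont_on_subset[OF real_solution_abs_cont(1)[OF \<psi>] sub]
    abs_cont_on_subset[OF real_solution_abs_cont(2)[OF \<psi>] sub]
  have nz: "\<phi> t * \<psi> t \<noteq> 0" if "t \<in> {a..b}" for t using nonzero[of t] that ab by auto
  obtain L where L: "L-lipschitz_on {a..b} ?r"
  proof (rule C1_imp_lipschitz_on)
    let ?r' = "\<lambda>t. - 2 * (\<phi>' t * \<psi> t + \<phi> t * \<psi>' t) / (\<phi> t * \<psi> t) ^ 3"
    show "continuous_on {a..b} ?r'"
      using nz by (intro continuous_intros cont) auto
    fix t assume t: "t \<in> {a..b}"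
    then have t': "t \<in> {0<..<1}" using ab by auto
    note d = real_solution_deriv[OF \<phi> t'] real_solution_deriv[OF \<psi> t']
    have "((\<lambda>t. \<phi> t * \<psi> t) has_real_derivative (\<phi>' t * \<psi> t + \<phi> t * \<psi>' t)) (at t)"
      by (rule derivative_eq_intros d refl | simp)+
    then have "(?r has_real_derivative ?r' t) (at t)"
      using nz[OF t] by (rule DERIV_inverse_square)
    then show "(?r has_vector_derivative ?r' t) (at t within {a..b})"
      by (simp add: has_real_derivative_iff_has_vector_derivative has_vector_derivative_at_within)
  qed
  have c2: "abs_cont_on {a..b} (\<lambda>_. 2 :: real)"
    by (rule lipschitz_on_imp_abs_cont_on[OF lipschitz_on_constant])
  have "abs_cont_on {a..b} (\<lambda>t. ?r t - 2 * ((\<phi>' t * \<psi> t) * ?r t))"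
    using ac c2 lipschitz_on_imp_abs_cont_on[OF L]
    by (intro abs_cont_on_diff abs_cont_on_mult) (auto simp: is_interval_cc)
  then show ?thesis
  proof (rule abs_cont_on_cong)
    fix t assume t: "t \<in> {a..b}"
    then have t': "t \<in> {0<..<1}" "t \<in> {0..1}" using ab by auto
    have "\<phi> t * \<psi>' t = \<phi>' t * \<psi> t - 1" using wronskian[OF t'(2)] by simp
    then show "?r t - 2 * ((\<phi>' t * \<psi> t) * ?r t) = deriv (spectral_datum q) t"
      unfolding deriv_spectral_datum[OF t'(1)] by (simp add: diff_divide_distrib[symmetric])
  qed
qed

end

lemma potential_eq_reconstruct_ae:
  assumes "q \<in> potentials"
  shows "AE x\<in>{0<..<1} in lebesgue. deriv (spectral_datum q) field_differentiable (at x) \<and>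
        q x = reconstruct (spectral_datum q) x"
proof -
  obtain \<phi> \<phi>' \<psi> \<psi>' N M where "dirichlet_pair q \<phi> \<phi>' \<psi> \<psi>' N M"
    using assms by (rule dirichlet_pair_exists)
  then interpret dirichlet_pair q \<phi> \<phi>' \<psi> \<psi>' N M .
  show ?thesis
  proof (rule AE_lebesgueI)
    show "negligible (N \<union> M)" using \<phi> \<psi> by (simp add: real_solution_def)
    show "x \<in> {0<..<1} \<longrightarrow> deriv (spectral_datum q) field_differentiable (at x) \<and>
        q x = reconstruct (spectral_datum q) x" if "x \<notin> N \<union> M" for x
      using deriv_spectral_datum_has_derivative[of x] reconstruct_spectral_datum[of x] that
      unfolding field_differentiable_def by blast
  qed
qed

theorem proposition4p3:
  fixes q :: "real \<Rightarrow> real"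
  assumes "q \<in> potentials"
  shows
    "(\<forall>t\<in>{0<..<1}. {\<mu>. is_eigenvalue q t \<mu>} = {complex_of_real (spectral_datum q t)} \<and>
                     spectral_datum q t \<noteq> 0) \<and>
     (\<forall>p\<in>potentials. (\<forall>t\<in>{0<..<1}. spectral_datum p t = spectral_datum q t) \<longrightarrow>
                      (AE x\<in>{0..1} in lebesgue. p x = q x)) \<and>
     (\<forall>x\<in>{0<..<1}. spectral_datum q field_differentiable (at x)) \<and>
     (\<forall>a b. 0 < a \<and> a < b \<and> b < 1 \<longrightarrow> abs_cont_on {a..b} (deriv (spectral_datum q))) \<and>
     (AE x\<in>{0<..<1} in lebesgue.
        deriv (spectral_datum q) field_differentiable (at x) \<and>
        q x = reconstruct (spectral_datum q) x)"
proof -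
  obtain \<phi> \<phi>' \<psi> \<psi>' N M where "dirichlet_pair q \<phi> \<phi>' \<psi> \<psi>' N M"
    using assms by (rule dirichlet_pair_exists)
  then interpret dirichlet_pair q \<phi> \<phi>' \<psi> \<psi>' N M .
  show ?thesis
  proof (intro conjI ballI allI impI)
    fix t :: real assume t: "t \<in> {0<..<1}"
    show "{\<mu>. is_eigenvalue q t \<mu>} = {complex_of_real (spectral_datum q t)}"
      by (simp only: eigenvalues[OF t] spectral_datum_eq[OF t])
    show "spectral_datum q t \<noteq> 0"
      using nonzero[OF t] by (simp add: spectral_datum_eq[OF t])
    show "spectral_datum q field_differentiable (at t)"
      using spectral_datum_has_derivative[OF t] unfolding field_differentiable_def by blast
  next
    fix p assume p: "p \<in> potentials" and eq: "\<forall>t\<in>{0<..<1}. spectral_datum p t = spectral_datum q t"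
    have rec: "reconstruct (spectral_datum p) x = reconstruct (spectral_datum q) x" if "x \<in> {0<..<1}" for x
      by (rule reconstruct_cong[OF _ that]) (use eq in blast)
    have "AE x in lebesgue. x \<notin> {0, 1::real}"
      by (rule AE_lebesgueI[of "{0,1}"]) auto
    with potential_eq_reconstruct_ae[OF p] potential_eq_reconstruct_ae[OF assms]
    show "AE x\<in>{0..1} in lebesgue. p x = q x"
    proof eventually_elim
      case (elim x)
      then show ?case using rec[of x] by (auto simp: less_le)
    qed
  next
    fix a b :: real assume "0 < a \<and> a < b \<and> b < 1"
    then show "abs_cont_on {a..b} (deriv (spectral_datum q))"
      by (intro abs_cont_on_deriv_spectral_datum) auto
  qed (rule potential_eq_reconstruct_ae[OF assms])
qed

end
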